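(* Let $\mathfrak{A}=\{\Gamma_i\}_i$ be a family of access structures for parties $\bm{B}=B_1,\ldots,B_n$ that contains at least two distinct access structures. Let $(\mathfrak{A},\psi_{AD},\mathcal{E}_{DQ\to\bm{B}},\{M_{a|i}\}_{a,i})$ be any programmable access structure (PAS) for input system $Q$ and parties $\bm{B}$ that realizes the programming of $\mathfrak{A}$. Then the PAS requires steering of the dealer's system $D$ using the shared state $\psi_{AD}$; that is, the state assemblage $$\sigma_{a|i}=\mathrm{Tr}_A[(M_{a|i}\otimes \mathbb{I}_D)\psi_{AD}]$$ does not admit a local hidden state model: there do not exist positive semidefinite operators $\{\rho_\lambda\}_\lambda$ on $\mathcal{H}_D$ with $\sum_\lambda \mathrm{Tr}[\rho_\lambda]=1$ and conditional probability distributions $p(a|i,\lambda)$ such that $\sigma_{a|i}=\sum_\lambda p(a|i,\lambda)\rho_\lambda$ for all $a,i$.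
   Context: All Hilbert spaces are finite-dimensional; $|X|$ denotes the dimension of $\mathcal{H}_X$, and $\mathcal{H}_{\bm{B}}=\mathcal{H}_{B_1}\otimes\cdots\otimes\mathcal{H}_{B_n}$. QSS code. A quantum secret sharing (QSS) code for $Q$ and parties $\bm{B}$ is a subspace $\mathcal{V}\subset\mathcal{H}_{\bm{B}}$ with $\mathcal{V}\cong\mathcal{H}_Q$ (i.e. $\dim\mathcal{V}=|Q|$). For a subset $S\subset\{B_1,\ldots,B_n\}$ with complement $\overline{S}$, $S$ is authorized if there is a quantum channel (CPTP map) $\mathcal{R}_S$ from $S$ to $\bm{B}$ with $\mathcal{R}_S\circ\mathrm{Tr}_{\overline{S}}\circ\Pi_{\mathcal{V}}=\Pi_{\mathcal{V}}$, where $\Pi_{\mathcal{V}}(\cdot)=P_{\mathcal{V}}(\cdot)P_{\mathcal{V}}$ and $P_{\mathcal{V}}$ is the orthogonal projector onto $\mathcal{V}$. The access structure $\Gamma\subset 2^{\{B_1,\ldots,B_n\}}$ of the code is the set of its authorized subsets. A subspace $\mathcal{V}\subset\mathcal{H}_A\otimes\mathcal{H}_{\bm{B}}$ is a code for $Q$ that can correct the erasure of $A$ if $\mathcal{V}\cong\mathcal{H}_Q$ and there is a quantum channel $\mathcal{R}$ from $\bm{B}$ to $A\bm{B}$ with $\mathcal{R}\circ\mathrm{Tr}_A\circ\Pi_{\mathcal{V}}=\Pi_{\mathcal{V}}$. PAS. A programmable access structure for input system $Q$ and parties $\bm{B}$ is a tuple $(\mathfrak{A},\psi_{AD},\mathcal{E}_{DQ\to\bm{B}},\{M_{a|i}\}_{a,i})$,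 where $\mathfrak{A}=\{\Gamma_i\}_i$ is a family of access structures $\Gamma_i\subset 2^{\{B_1,\ldots,B_n\}}$; $\psi_{AD}$ is a (pure or mixed) density operator on $\mathcal{H}_A\otimes\mathcal{H}_D$ ($A$ is held by the programmer, $D$ by the dealer); $\mathcal{E}_{DQ\to\bm{B}}$ is a CPTP map from operators on $\mathcal{H}_D\otimes\mathcal{H}_Q$ to operators on $\mathcal{H}_{\bm{B}}$; and for each $i$, $\{M_{a|i}\}_a$ is a POVM on $\mathcal{H}_A$ ($M_{a|i}\ge 0$, $\sum_a M_{a|i}=\mathbb{I}_A$), such that: (i) for every $i$ and every outcome $a$, the subspace $$\mathcal{V}_{a|i}=\mathrm{supp}\{\mathrm{Tr}_A[(M_{a|i}\otimes\mathbb{I}_{\bm{B}})\,(\mathrm{id}_A\otimes\mathcal{E}_{DQ\to\bm{B}})(\psi_{AD}\otimes\mathbb{I}_Q)]\}$$ is a QSS code for $Q$ with access structure $\Gamma_i$; (ii) $\mathcal{V}=\mathrm{supp}\{(\mathrm{id}_A\otimes\mathcal{E}_{DQ\to\bm{B}})(\psi_{AD}\otimes\mathbb{I}_Q)\}$ is a code for $Q$ that can correct the erasure of $A$. Such a tuple is said to realize a programming of $\mathfrak{A}$. Here $\mathrm{supp}$ denotes the support (range) of a positive operator. *)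

theory Defs
  imports "HOL-Analysis.Analysis" "HOL-Library.Function_Algebras"
begin

text \<open>
  A finite-dimensional Hilbert space is represented as the coordinate space over a finite nonempty
  set \<open>I\<close> labelling an orthonormal basis, so \<open>dim = card I\<close>. Vectors and operators are total
  functions that vanish outside \<open>I\<close> and \<open>I \<times> I\<close>, so that equality on the space is equality of
  functions. The tensor product of the spaces over \<open>I\<close> and \<open>J\<close> is the space over \<open>I \<times> J\<close>; the tensor
  product of a family \<open>Bs\<close> over a set \<open>S\<close> of parties is the space over \<open>PiE S Bs\<close> (one-dimensional
  for empty \<open>S\<close>). Addition of functions is pointwise; their pointwise product is never used.
\<close>

type_synonym 'i vector = "'i \<Rightarrow> complex"
type_synonym 'i operator = "'i \<Rightarrow> 'i \<Rightarrow> complex"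

definition hilbert_basis :: "'i set \<Rightarrow> bool" where
  "hilbert_basis I \<longleftrightarrow> finite I \<and> I \<noteq> {}"

definition vectors :: "'i set \<Rightarrow> 'i vector set" where
  "vectors I = {v. \<forall>x. x \<notin> I \<longrightarrow> v x = 0}"

definition operators :: "'i set \<Rightarrow> 'i operator set" where
  "operators I = {X. \<forall>x y. x \<notin> I \<or> y \<notin> I \<longrightarrow> X x y = 0}"

definition vscale :: "complex \<Rightarrow> 'i vector \<Rightarrow> 'i vector" where
  "vscale c v = (\<lambda>x. c * v x)"

interpretation cvec: vector_space vscale
  by unfold_locales (auto simp: vscale_def plus_fun_def algebra_simps)

definition op_scale :: "complex \<Rightarrow> 'i operator \<Rightarrow> 'i operator" where
  "op_scale c X = (\<lambda>x y. c * X x y)"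

definition op_id :: "'i set \<Rightarrow> 'i operator" where
  "op_id I = (\<lambda>x y. if x \<in> I \<and> x = y then 1 else 0)"

definition op_mult :: "'i set \<Rightarrow> 'i operator \<Rightarrow> 'i operator \<Rightarrow> 'i operator" where
  "op_mult I X Y = (\<lambda>x z. \<Sum>y\<in>I. X x y * Y y z)"

definition op_adjoint :: "'i operator \<Rightarrow> 'i operator" where
  "op_adjoint X = (\<lambda>x y. cnj (X y x))"

definition op_apply :: "'i set \<Rightarrow> 'i operator \<Rightarrow> 'i vector \<Rightarrow> 'i vector" where
  "op_apply I X v = (\<lambda>x. \<Sum>y\<in>I. X x y * v y)"

definition op_trace :: "'i set \<Rightarrow> 'i operator \<Rightarrow> complex" where
  "op_trace I X = (\<Sum>x\<in>I. X x x)"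

definition positive :: "'i set \<Rightarrow> 'i operator \<Rightarrow> bool" where
  "positive I X \<longleftrightarrow> X \<in> operators I \<and>
     (\<forall>v\<in>vectors I. (\<Sum>x\<in>I. cnj (v x) * op_apply I X v x) \<in> \<real>\<^sub>\<ge>\<^sub>0)"

definition density_operator :: "'i set \<Rightarrow> 'i operator \<Rightarrow> bool" where
  "density_operator I X \<longleftrightarrow> positive I X \<and> op_trace I X = 1"

definition supp :: "'i set \<Rightarrow> 'i operator \<Rightarrow> 'i vector set" where
  "supp I X = op_apply I X ` vectors I"

definition povm :: "'i set \<Rightarrow> 'o set \<Rightarrow> ('o \<Rightarrow> 'i operator) \<Rightarrow> bool" where
  "povm I Out M \<longleftrightarrow> finite Out \<and> (\<forall>a\<in>Out. positive I (M a)) \<and> (\<Sum>a\<in>Out. M a) = op_id I"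

definition subspace_of :: "'i set \<Rightarrow> 'i vector set \<Rightarrow> bool" where
  "subspace_of I V \<longleftrightarrow> V \<subseteq> vectors I \<and> cvec.subspace V"

definition orth_projector :: "'i set \<Rightarrow> 'i vector set \<Rightarrow> 'i operator \<Rightarrow> bool" where
  "orth_projector I V P \<longleftrightarrow>
     P \<in> operators I \<and> op_mult I P P = P \<and> op_adjoint P = P \<and> supp I P = V"

definition compress :: "'i set \<Rightarrow> 'i operator \<Rightarrow> 'i operator \<Rightarrow> 'i operator" where
  "compress I P X = op_mult I (op_mult I P X) P"

definition op_tensor :: "'i operator \<Rightarrow> 'j operator \<Rightarrow> ('i \<times> 'j) operator" where
  "op_tensor X Y = (\<lambda>(x, y) (x', y'). X x x' * Y y y')"

definition op_assoc :: "(('i \<times> 'j) \<times> 'k) operator \<Rightarrow> ('i \<times> 'j \<times> 'k) operator" where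
  "op_assoc X = (\<lambda>(x, y, z) (x', y', z'). X ((x, y), z) ((x', y'), z'))"

definition ptrace_fst :: "'i set \<Rightarrow> ('i \<times> 'j) operator \<Rightarrow> 'j operator" where
  "ptrace_fst I X = (\<lambda>y y'. \<Sum>x\<in>I. X (x, y) (x, y'))"

text \<open>The trace over the parties in \<open>N - S\<close>, leaving an operator on the parties in \<open>S \<subseteq> N\<close>.\<close>

definition ptrace_parties ::
    "'p set \<Rightarrow> ('p \<Rightarrow> 'b set) \<Rightarrow> 'p set \<Rightarrow> ('p \<Rightarrow> 'b) operator \<Rightarrow> ('p \<Rightarrow> 'b) operator" where
  "ptrace_parties N Bs S X = (\<lambda>y y'.
     if y \<in> PiE S Bs \<and> y' \<in> PiE S Bs
     then \<Sum>z\<in>PiE (N - S) Bs. X (merge S (N - S) (y, z)) (merge S (N - S) (y', z))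
     else 0)"

text \<open>The map \<open>id \<otimes> \<Phi>\<close>, acting blockwise.\<close>

definition id_tensor :: "('i operator \<Rightarrow> 'j operator) \<Rightarrow> ('k \<times> 'i) operator \<Rightarrow> ('k \<times> 'j) operator" where
  "id_tensor \<Phi> X = (\<lambda>(r, y) (s, y'). \<Phi> (\<lambda>x x'. X (r, x) (s, x')) y y')"

definition completely_positive ::
    "'i set \<Rightarrow> 'j set \<Rightarrow> ('i operator \<Rightarrow> 'j operator) \<Rightarrow> bool" where
  "completely_positive I J \<Phi> \<longleftrightarrow>
     (\<forall>k::nat. \<forall>X. positive ({..<k} \<times> I) X \<longrightarrow> positive ({..<k} \<times> J) (id_tensor \<Phi> X))"

text \<open>The values of a channel outside \<open>operators I\<close> are unconstrained.\<close>

definition channel :: "'i set \<Rightarrow> 'j set \<Rightarrow> ('i operator \<Rightarrow> 'j operator) \<Rightarrow> bool" where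
  "channel I J \<Phi> \<longleftrightarrow>
     (\<forall>X\<in>operators I. \<Phi> X \<in> operators J) \<and>
     (\<forall>X\<in>operators I. \<forall>Y\<in>operators I. \<Phi> (X + Y) = \<Phi> X + \<Phi> Y) \<and>
     (\<forall>c. \<forall>X\<in>operators I. \<Phi> (op_scale c X) = op_scale c (\<Phi> X)) \<and>
     completely_positive I J \<Phi> \<and>
     (\<forall>X\<in>operators I. op_trace J (\<Phi> X) = op_trace I X)"

definition qss_code :: "'p set \<Rightarrow> ('p \<Rightarrow> 'b set) \<Rightarrow> 'q set \<Rightarrow> ('p \<Rightarrow> 'b) vector set \<Rightarrow> bool" where
  "qss_code N Bs Q V \<longleftrightarrow> subspace_of (PiE N Bs) V \<and> cvec.dim V = card Q"

definition authorized ::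
    "'p set \<Rightarrow> ('p \<Rightarrow> 'b set) \<Rightarrow> ('p \<Rightarrow> 'b) vector set \<Rightarrow> 'p set \<Rightarrow> bool" where
  "authorized N Bs V S \<longleftrightarrow>
     (\<exists>P R. orth_projector (PiE N Bs) V P \<and> channel (PiE S Bs) (PiE N Bs) R \<and>
       (\<forall>X\<in>operators (PiE N Bs).
          R (ptrace_parties N Bs S (compress (PiE N Bs) P X)) = compress (PiE N Bs) P X))"

definition access_structure ::
    "'p set \<Rightarrow> ('p \<Rightarrow> 'b set) \<Rightarrow> ('p \<Rightarrow> 'b) vector set \<Rightarrow> 'p set set" where
  "access_structure N Bs V = {S. S \<subseteq> N \<and> authorized N Bs V S}"

definition erasure_code :: "'a set \<Rightarrow> 'j set \<Rightarrow> 'q set \<Rightarrow> ('a \<times> 'j) vector set \<Rightarrow> bool" where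
  "erasure_code A J Q V \<longleftrightarrow> subspace_of (A \<times> J) V \<and> cvec.dim V = card Q \<and>
     (\<exists>P R. orth_projector (A \<times> J) V P \<and> channel J (A \<times> J) R \<and>
       (\<forall>X\<in>operators (A \<times> J).
          R (ptrace_fst A (compress (A \<times> J) P X)) = compress (A \<times> J) P X))"

text \<open>
  In the following predicate \<open>\<tau>\<close> is the operator
  \<open>(id\<^sub>A \<otimes> \<E>)(\<psi>\<^sub>A\<^sub>D \<otimes> \<I>\<^sub>Q)\<close> on \<open>A \<otimes> B\<close>; \<open>M a i\<close> is the POVM element for outcome \<open>a\<close> of setting \<open>i\<close>, and
  each setting has its own finite set \<open>Out i\<close> of outcomes.
\<close>

definition programmable_access_structure ::
    "'p set \<Rightarrow> ('p \<Rightarrow> 'b set) \<Rightarrow> 'a set \<Rightarrow> 'd set \<Rightarrow> 'q set \<Rightarrow> 'i set \<Rightarrow> ('i \<Rightarrow> 'o set) \<Rightarrow>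
     ('i \<Rightarrow> 'p set set) \<Rightarrow> ('a \<times> 'd) operator \<Rightarrow>
     (('d \<times> 'q) operator \<Rightarrow> ('p \<Rightarrow> 'b) operator) \<Rightarrow> ('o \<Rightarrow> 'i \<Rightarrow> 'a operator) \<Rightarrow> bool" where
  "programmable_access_structure N Bs A D Q Idx Out \<Gamma> \<psi> \<E> M \<longleftrightarrow>
     (\<forall>i\<in>Idx. \<Gamma> i \<subseteq> Pow N) \<and>
     density_operator (A \<times> D) \<psi> \<and>
     channel (D \<times> Q) (PiE N Bs) \<E> \<and>
     (\<forall>i\<in>Idx. povm A (Out i) (\<lambda>a. M a i)) \<and>
     (let B = PiE N Bs;
          \<tau> = id_tensor \<E> (op_assoc (op_tensor \<psi> (op_id Q)))
      in (\<forall>i\<in>Idx. \<forall>a\<in>Out i.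
            let V = supp B (ptrace_fst A (op_mult (A \<times> B) (op_tensor (M a i) (op_id B)) \<tau>))
            in qss_code N Bs Q V \<and> access_structure N Bs V = \<Gamma> i) \<and>
         erasure_code A B Q (supp (A \<times> B) \<tau>))"

definition assemblage ::
    "'a set \<Rightarrow> 'd set \<Rightarrow> ('a \<times> 'd) operator \<Rightarrow> ('o \<Rightarrow> 'i \<Rightarrow> 'a operator) \<Rightarrow> 'o \<Rightarrow> 'i \<Rightarrow> 'd operator" where
  "assemblage A D \<psi> M a i = ptrace_fst A (op_mult (A \<times> D) (op_tensor (M a i) (op_id D)) \<psi>)"

text \<open>
  Hidden variables range over a set \<open>\<Lambda>\<close> of any cardinality, and sums over \<open>\<Lambda>\<close> are taken entrywise in
  the sense of \<open>has_sum\<close>; for finite \<open>\<Lambda>\<close> these are ordinary sums.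
\<close>

definition local_hidden_state_model ::
    "'d set \<Rightarrow> 'i set \<Rightarrow> ('i \<Rightarrow> 'o set) \<Rightarrow> ('o \<Rightarrow> 'i \<Rightarrow> 'd operator) \<Rightarrow>
     'l set \<Rightarrow> ('l \<Rightarrow> 'd operator) \<Rightarrow> ('o \<Rightarrow> 'i \<Rightarrow> 'l \<Rightarrow> real) \<Rightarrow> bool" where
  "local_hidden_state_model D Idx Out \<sigma> \<Lambda> \<rho> p \<longleftrightarrow>
     (\<forall>l\<in>\<Lambda>. positive D (\<rho> l)) \<and>
     ((\<lambda>l. op_trace D (\<rho> l)) has_sum 1) \<Lambda> \<and>
     (\<forall>i\<in>Idx. \<forall>l\<in>\<Lambda>. (\<forall>a\<in>Out i. 0 \<le> p a i l) \<and> (\<Sum>a\<in>Out i. p a i l) = 1) \<and>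
     (\<forall>i\<in>Idx. \<forall>a\<in>Out i. \<forall>x\<in>D. \<forall>y\<in>D.
        ((\<lambda>l. of_real (p a i l) * \<rho> l x y) has_sum \<sigma> a i x y) \<Lambda>)"

end

theory Submission
  imports Defs
begin

text \<open>
  Write \<open>T\<^sub>m v = (\<langle>m| \<otimes> 1) v\<close>. If the erasure of \<open>A\<close> can be corrected on \<open>V\<close>, then
  \<open>\<langle>T\<^sub>m v, T\<^sub>m\<^sub>' v'\<rangle> = c(m, m') \<langle>v, v'\<rangle>\<close> on \<open>V\<close>, so each \<open>T\<^sub>m\<close> is a multiple of an isometry, and two
  images \<open>T\<^sub>m V\<close>, \<open>T\<^sub>m\<^sub>' V\<close> that share a nonzero vector are equal. Decomposing \<open>M\<^sub>a\<^sub>|\<^sub>i\<close> into rank-one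
  operators and counting dimensions, every \<open>V\<^sub>a\<^sub>|\<^sub>i\<close> is one of these images. Given a local hidden
  state model, pick a hidden state \<open>\<rho>\<^sub>\<lambda> \<noteq> 0\<close>. For every setting \<open>i\<close> some outcome \<open>a\<close> has
  \<open>p(a|i,\<lambda>) > 0\<close>, and then \<open>V\<^sub>a\<^sub>|\<^sub>i\<close> contains the support of \<open>\<E>(\<rho>\<^sub>\<lambda> \<otimes> 1)\<close>. Hence these subspaces
  coincide for all settings, and so do the access structures.
\<close>

subsection \<open>Positive operators\<close>

definition cinner :: "'i set \<Rightarrow> 'i vector \<Rightarrow> 'i vector \<Rightarrow> complex" where
  "cinner I v w = (\<Sum>x\<in>I. cnj (v x) * w x)"

definition ket :: "'i \<Rightarrow> 'i vector" where
  "ket x = (\<lambda>y. if y = x then 1 else 0)"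

definition outer :: "'i vector \<Rightarrow> 'i vector \<Rightarrow> 'i operator" where
  "outer v w = (\<lambda>x y. v x * cnj (w y))"

section \<open>Coordinates: vectors, operators and the inner product\<close>

lemma sum_fun_app: "(\<Sum>k\<in>K. f k) x = (\<Sum>k\<in>K. f k x)"
  for f :: "'k \<Rightarrow> 'x \<Rightarrow> 'y::comm_monoid_add"
  by (induction K rule: infinite_finite_induct) auto

lemma vectors_add: "v \<in> vectors I \<Longrightarrow> w \<in> vectors I \<Longrightarrow> v + w \<in> vectors I"
  and vectors_diff: "v \<in> vectors I \<Longrightarrow> w \<in> vectors I \<Longrightarrow> v - w \<in> vectors I"
  and vectors_vscale: "v \<in> vectors I \<Longrightarrow> vscale c v \<in> vectors I"
  and vectors_ket: "x \<in> I \<Longrightarrow> ket x \<in> vectors I"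
  and vectors_0: "0 \<in> vectors I"
  by (auto simp: vectors_def vscale_def ket_def)

lemma vectors_op_apply: "X \<in> operators I \<Longrightarrow> op_apply I X v \<in> vectors I"
  by (auto simp: vectors_def operators_def op_apply_def)

lemma vectors_eqI:
  assumes "v \<in> vectors I" "w \<in> vectors I" "\<And>x. x \<in> I \<Longrightarrow> v x = w x"
  shows "v = w"
  using assms by (fastforce simp: vectors_def)

lemma operators_eqI:
  assumes "X \<in> operators I" "Y \<in> operators I" "\<And>x y. x \<in> I \<Longrightarrow> y \<in> I \<Longrightarrow> X x y = Y x y"
  shows "X = Y"
proof (intro ext)
  fix x y
  show "X x y = Y x y"
    using assms by (cases "x \<in> I \<and> y \<in> I") (auto simp: operators_def)
qed

lemma operators_outer: "v \<in> vectors I \<Longrightarrow> w \<in> vectors I \<Longrightarrow> outer v w \<in> operators I"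
  by (auto simp: outer_def vectors_def operators_def)

lemma operators_op_scale: "X \<in> operators I \<Longrightarrow> op_scale c X \<in> operators I"
  by (auto simp: op_scale_def operators_def)

lemma operators_sum: "(\<And>k. k \<in> K \<Longrightarrow> X k \<in> operators I) \<Longrightarrow> (\<Sum>k\<in>K. X k) \<in> operators I"
  by (auto simp: operators_def sum_fun_app intro!: sum.neutral)

lemma cinner_simps:
  "cinner I (u + v) w = cinner I u w + cinner I v w"
  "cinner I w (u + v) = cinner I w u + cinner I w v"
  "cinner I (u - v) w = cinner I u w - cinner I v w"
  "cinner I w (u - v) = cinner I w u - cinner I w v"
  "cinner I (vscale c v) w = cnj c * cinner I v w"
  "cinner I w (vscale c v) = c * cinner I w v"
  "cinner I 0 w = 0"
  "cinner I w 0 = 0"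
  by (simp_all add: cinner_def vscale_def algebra_simps sum.distrib sum_subtractf sum_distrib_left)

lemma cinner_commute: "cinner I w v = cnj (cinner I v w)"
  by (simp add: cinner_def mult.commute)

lemma cinner_self: "cinner I v v = of_real (\<Sum>x\<in>I. (cmod (v x))\<^sup>2)"
  by (simp add: cinner_def complex_norm_square mult.commute flip: of_real_power)

lemma cinner_self_eq_0_iff:
  assumes "finite I" "v \<in> vectors I"
  shows "cinner I v v = 0 \<longleftrightarrow> v = 0"
proof
  assume "cinner I v v = 0"
  then have "\<forall>x\<in>I. v x = 0"
    using assms(1) by (simp add: cinner_self del: of_real_sum) (simp add: sum_nonneg_eq_0_iff)
  then show "v = 0"
    using assms(2) by (auto simp: vectors_def fun_eq_iff)
qed (simp add: cinner_simps)

lemma cinner_ket: "finite I \<Longrightarrow> x \<in> I \<Longrightarrow> cinner I (ket x) v = v x"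
  by (simp add: cinner_def ket_def if_distrib[of cnj] if_distrib[of "\<lambda>c. c * _"] cong: if_cong)

lemma op_apply_ket: "finite I \<Longrightarrow> x \<in> I \<Longrightarrow> op_apply I X (ket x) = (\<lambda>y. X y x)"
  by (simp add: op_apply_def ket_def if_distrib[of "\<lambda>c. _ * c"] cong: if_cong)

lemma op_apply_simps:
  "op_apply I X (u + v) = op_apply I X u + op_apply I X v"
  "op_apply I X (u - v) = op_apply I X u - op_apply I X v"
  "op_apply I X (vscale c v) = vscale c (op_apply I X v)"
  by (simp_all add: op_apply_def vscale_def fun_eq_iff algebra_simps sum.distrib sum_subtractf
      sum_distrib_left)

lemma cinner_op_apply: "cinner I v (op_apply I X w) = (\<Sum>x\<in>I. \<Sum>y\<in>I. cnj (v x) * X x y * w y)"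
  by (simp add: cinner_def op_apply_def sum_distrib_left mult.assoc)

lemma cinner_op_apply_lin:
  "cinner I v (op_apply I (X + Y) w) = cinner I v (op_apply I X w) + cinner I v (op_apply I Y w)"
  "cinner I v (op_apply I (X - Y) w) = cinner I v (op_apply I X w) - cinner I v (op_apply I Y w)"
  "cinner I v (op_apply I (op_scale c X) w) = c * cinner I v (op_apply I X w)"
  by (simp_all add: cinner_op_apply op_scale_def algebra_simps sum.distrib sum_subtractf
      sum_distrib_left)

lemma cinner_outer: "cinner I v (op_apply I (outer s t) w) = cinner I v s * cinner I t w"
  unfolding cinner_op_apply by (simp add: outer_def cinner_def sum_product mult_ac)

section \<open>Quadratic forms, kernels and supports of positive operators\<close>

lemma positive_operators: "positive I X \<Longrightarrow> X \<in> operators I"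
  by (simp add: positive_def)

lemma positive_cinner:
  "positive I X \<Longrightarrow> v \<in> vectors I \<Longrightarrow> cinner I v (op_apply I X v) \<in> \<real>\<^sub>\<ge>\<^sub>0"
  by (simp add: positive_def cinner_def)

lemma positiveI:
  "X \<in> operators I \<Longrightarrow> (\<And>v. v \<in> vectors I \<Longrightarrow> cinner I v (op_apply I X v) \<in> \<real>\<^sub>\<ge>\<^sub>0) \<Longrightarrow> positive I X"
  by (simp add: positive_def cinner_def)

text \<open>Polarization: positivity only says that the quadratic form is real and nonnegative.
  Reality on \<open>v + w\<close> controls the imaginary parts of the mixed terms, reality on
  \<open>v + \<i> w\<close> their real parts, and together they make the form hermitian.\<close>

lemma positive_adjoint:
  assumes "positive I X" "v \<in> vectors I" "w \<in> vectors I"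
  shows "cinner I v (op_apply I X w) = cinner I (op_apply I X v) w"
proof -
  let ?b = "\<lambda>v w. cinner I v (op_apply I X w)"
  have real: "Im (?b u u) = 0" if "u \<in> vectors I" for u
    using positive_cinner[OF assms(1) that] by (auto simp: complex_nonneg_Reals_iff)
  have "Im (?b v w) + Im (?b w v) = 0"
    using real[OF vectors_add[OF assms(2,3)]] real[OF assms(2)] real[OF assms(3)]
    by (simp add: op_apply_simps cinner_simps)
  moreover have "Re (?b v w) = Re (?b w v)"
    using real[OF vectors_add[OF assms(2) vectors_vscale[OF assms(3), of \<i>]]]
      real[OF assms(2)] real[OF assms(3)]
    by (simp add: op_apply_simps cinner_simps)
  ultimately have "?b v w = cnj (?b w v)"
    by (simp add: complex_eq_iff)
  then show ?thesis
    using cinner_commute[of I "op_apply I X v" w] by simp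
qed

lemma positive_hermitian:
  assumes "finite I" "positive I X"
  shows "X y x = cnj (X x y)"
proof (cases "x \<in> I \<and> y \<in> I")
  case True
  then have "X y x = cinner I (ket y) (op_apply I X (ket x))"
    using assms(1) by (simp add: cinner_ket op_apply_ket)
  also have "\<dots> = cinner I (op_apply I X (ket y)) (ket x)"
    using True by (intro positive_adjoint[OF assms(2)] vectors_ket) auto
  also have "\<dots> = cnj (X x y)"
    using True assms(1) cinner_commute[of I "op_apply I X (ket y)" "ket x"]
    by (simp add: cinner_ket op_apply_ket)
  finally show ?thesis .
next
  case False
  then show ?thesis
    using positive_operators[OF assms(2)] by (auto simp: operators_def)
qed

text \<open>Testing positivity on \<open>w - t X w\<close> for small \<open>t > 0\<close>.\<close>

lemma positive_kernel:
  assumes "finite I" "positive I X" "w \<in> vectors I" "cinner I w (op_apply I X w) = 0"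
  shows "op_apply I X w = 0"
proof -
  let ?u = "op_apply I X w"
  have u: "?u \<in> vectors I"
    using assms(2) by (simp add: positive_operators vectors_op_apply)
  obtain \<alpha> where \<alpha>: "cinner I ?u ?u = of_real \<alpha>" "\<alpha> \<ge> 0"
    by (simp add: cinner_self sum_nonneg del: of_real_sum)
  obtain \<beta> where \<beta>: "cinner I ?u (op_apply I X ?u) = of_real \<beta>" "\<beta> \<ge> 0"
    using positive_cinner[OF assms(2) u] by (auto elim: nonneg_Reals_cases)
  have wu: "cinner I w (op_apply I X ?u) = of_real \<alpha>"
    using positive_adjoint[OF assms(2,3) u] \<alpha> by simp
  \<comment> \<open>A small positive step along \<open>- ?u\<close> would make the form negative
    unless \<open>\<alpha> = 0\<close>; the \<open>+ 1\<close> keeps the denominator positive when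
    \<open>\<beta> = 0\<close>.\<close>
  define t where "t = \<alpha> / (\<beta> + 1)"
  have "cinner I (w - vscale (of_real t) ?u) (op_apply I X (w - vscale (of_real t) ?u)) =
      of_real (t\<^sup>2 * \<beta> - 2 * t * \<alpha>)"
    by (simp add: op_apply_simps cinner_simps assms(4) \<alpha> \<beta> wu algebra_simps power2_eq_square)
  then have "0 \<le> t\<^sup>2 * \<beta> - 2 * t * \<alpha>"
    using positive_cinner[OF assms(2) vectors_diff[OF assms(3) vectors_vscale[OF u, of "of_real t"]]]
    by (simp del: of_real_diff of_real_mult of_real_power)
  also have "\<dots> = - (\<alpha>\<^sup>2 * (\<beta> + 2)) / (\<beta> + 1)\<^sup>2"
    using \<beta>(2) by (simp add: t_def divide_simps power2_eq_square add_nonneg_eq_0_iff) (simp add: algebra_simps)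
  finally have "\<alpha>\<^sup>2 * (\<beta> + 2) / (\<beta> + 1)\<^sup>2 \<le> 0"
    by simp
  then have "\<alpha> = 0"
    using \<beta>(2) by (auto simp: divide_le_0_iff mult_le_0_iff)
  then show ?thesis
    using \<alpha> cinner_self_eq_0_iff[OF assms(1) u] by simp
qed

text \<open>Cholesky decomposition: eliminate one basis element at a time.\<close>

lemma positive_decomposition:
  assumes "finite I" "positive I X"
  obtains t where "\<And>k. k \<in> I \<Longrightarrow> t k \<in> vectors I" "X = (\<Sum>k\<in>I. outer (t k) (t k))"
proof -
  have "\<exists>t. (\<forall>k\<in>I. t k \<in> vectors I) \<and> X = (\<Sum>k\<in>I. outer (t k) (t k))"
    using assms
  proof (induction I arbitrary: X rule: finite_induct)
    case empty
    then show ?case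
      by (auto simp: positive_def operators_def zero_fun_def)
  next
    case (insert i I)
    let ?J = "insert i I"
    have fin: "finite ?J" using insert by simp
    define x where "x = op_apply ?J X (ket i)"
    have x: "x \<in> vectors ?J"
      using insert.prems by (simp add: x_def positive_operators vectors_op_apply)
    have xi: "x y = X y i" for y
      using fin by (simp add: x_def op_apply_ket)
    have ki: "ket i \<in> vectors ?J" by (simp add: vectors_ket)
    obtain d where d: "X i i = of_real d" "d \<ge> 0"
      using positive_cinner[OF insert.prems ki] fin
      by (auto elim!: nonneg_Reals_cases simp: cinner_ket op_apply_ket)
    \<comment> \<open>The pivot column, scaled so that \<open>outer s s\<close> reproduces row and
      column \<open>i\<close> of \<open>X\<close>. For a zero pivot, \<open>1 / 0 = 0\<close> gives
      \<open>s = 0\<close>, which fits because the whole column then vanishes.\<close>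
    define s where "s = vscale (of_real (1 / sqrt d)) x"
    have s: "s \<in> vectors ?J" by (simp add: s_def x vectors_vscale)
    have xz: "x = 0" if "d = 0"
      using positive_kernel[OF fin insert.prems ki] that d fin
      by (simp add: x_def cinner_ket op_apply_ket)
    define Y where "Y = X - outer s s"
    have outer_s: "outer s s y z = X y i * X i z / of_real d" for y z
    proof (cases "d = 0")
      case True
      then show ?thesis by (simp add: outer_def s_def vscale_def)
    next
      case False
      then have "complex_of_real (sqrt d) * of_real (sqrt d) = of_real d"
        using d by (simp flip: of_real_mult)
      then show ?thesis
        using False positive_hermitian[OF fin insert.prems, of z i]
        by (simp add: outer_def s_def vscale_def xi divide_simps mult_ac)
    qed
    have Xyi: "X y i = 0" "X i y = 0" if "d = 0" for y
      using xz[OF that] xi[of y] positive_hermitian[OF fin insert.prems, of i y] by auto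
    have "Y \<in> operators I"
    proof -
      have "Y \<in> operators ?J"
        using positive_operators[OF insert.prems] operators_outer[OF s s]
        by (auto simp: Y_def operators_def)
      moreover have "Y y i = 0" "Y i y = 0" for y
        by (cases "d = 0"; simp add: Y_def outer_s Xyi d)+
      ultimately show ?thesis by (simp add: operators_def) (metis (full_types))
    qed
    moreover have "cinner I v (op_apply I Y v) \<in> \<real>\<^sub>\<ge>\<^sub>0" if "v \<in> vectors I" for v
    proof -
      have v: "v \<in> vectors ?J" and vi: "v i = 0" using that insert.hyps by (auto simp: vectors_def)
      have "cinner I v (op_apply I Y v) = cinner ?J v (op_apply ?J Y v)"
        using insert.hyps vi by (simp add: cinner_def op_apply_def)
      also have "\<dots> \<in> \<real>\<^sub>\<ge>\<^sub>0"
      proof (cases "d = 0")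
        case True
        then have "s = 0" by (simp add: s_def xz vscale_def zero_fun_def)
        then have "Y = X" by (simp add: Y_def outer_def fun_eq_iff)
        then show ?thesis using positive_cinner[OF insert.prems v] by simp
      next
        case False
        define c where "c = cinner ?J x v"
        have 1: "cinner ?J (ket i) (op_apply ?J X v) = c"
          using positive_adjoint[OF insert.prems ki v] by (simp add: c_def x_def)
        have 2: "cinner ?J v (op_apply ?J X (ket i)) = cnj c"
          unfolding c_def x_def by (rule cinner_commute)
        have 3: "cinner ?J (ket i) (op_apply ?J X (ket i)) = of_real d"
          using fin d by (simp add: cinner_ket op_apply_ket)
        \<comment> \<open>Completing the square: \<open>?w\<close> differs from \<open>v\<close>
          only at \<open>i\<close> and makes \<open>X ?w\<close> vanish at \<open>i\<close>, so the
          form of \<open>X\<close> at \<open>?w\<close> is the form of the Schur complement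
          \<open>Y\<close> at \<open>v\<close>.\<close>
        let ?w = "v - vscale (c / of_real d) (ket i)"
        have "cinner ?J ?w (op_apply ?J X ?w) =
            cinner ?J v (op_apply ?J X v) - c * cnj c / of_real d"
          using False by (simp add: op_apply_simps cinner_simps 1 2 3 field_simps)
        also have "\<dots> = cinner ?J v (op_apply ?J Y v)"
        proof -
          have "complex_of_real (sqrt d) * of_real (sqrt d) = of_real d"
            using d by (simp flip: of_real_mult)
          moreover have "cinner ?J v x = cnj c" unfolding c_def by (rule cinner_commute)
          ultimately show ?thesis
            using False
            by (simp add: Y_def cinner_op_apply_lin cinner_outer s_def cinner_simps divide_simps mult_ac
                flip: c_def)
        qed
        finally show ?thesis
          using positive_cinner[OF insert.prems vectors_diff[OF v vectors_vscale[OF ki]]] by metis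
      qed
      finally show ?thesis .
    qed
    ultimately have "positive I Y" by (rule positiveI)
    then obtain t where t: "\<forall>k\<in>I. t k \<in> vectors I" "Y = (\<Sum>k\<in>I. outer (t k) (t k))"
      using insert.IH by blast
    let ?t = "t(i := s)"
    have "(\<Sum>k\<in>I. outer (?t k) (?t k)) = Y"
      unfolding t(2) using insert.hyps by (intro sum.cong) auto
    then have "X = (\<Sum>k\<in>?J. outer (?t k) (?t k))"
      using insert.hyps by (simp add: Y_def)
    moreover have "\<forall>k\<in>?J. ?t k \<in> vectors ?J"
      using t(1) s by (auto simp: vectors_def)
    ultimately show ?case by blast
  qed
  then show thesis using that by blast
qed

text \<open>Gram-Schmidt by induction: both \<open>x\<close> and the new vector \<open>s\<close> are
  projected onto the span of the earlier vectors, and the residual of \<open>s\<close> supplies the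
  one new direction.\<close>

lemma orthogonal_projection_ex:
  assumes "finite I" "finite S" "S \<subseteq> vectors I" "x \<in> vectors I"
  shows "\<exists>v\<in>cvec.span S. \<forall>s\<in>S. cinner I s (x - v) = 0"
  using assms(2-4)
proof (induction S arbitrary: x rule: finite_induct)
  case empty
  then show ?case by (auto intro: cvec.span_zero)
next
  case (insert s S)
  have span_vec: "cvec.span S \<subseteq> vectors I"
    using insert.prems(1)
    by (intro cvec.span_minimal) (auto simp: cvec.subspace_def vectors_0 vectors_add vectors_vscale)
  obtain v where v: "v \<in> cvec.span S" "\<forall>r\<in>S. cinner I r (x - v) = 0"
    using insert by blast
  obtain u where u: "u \<in> cvec.span S" "\<forall>r\<in>S. cinner I r (s - u) = 0"
    using insert by blast
  let ?s = "s - u"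
  have s: "?s \<in> vectors I" using insert.prems u(1) span_vec by (auto intro: vectors_diff)
  \<comment> \<open>If the residual \<open>?s\<close> is zero, this quotient is 0 and no direction
    is added.\<close>
  define c where "c = cinner I ?s (x - v) / cinner I ?s ?s"
  let ?y = "v + vscale c ?s"
  have "cvec.span S \<subseteq> cvec.span (insert s S)"
    by (intro cvec.span_mono) auto
  then have "?y \<in> cvec.span (insert s S)"
    using u(1) v(1)
    by (intro cvec.span_add cvec.span_scale cvec.span_diff) (auto intro: cvec.span_base)
  moreover have S: "cinner I r (x - ?y) = 0" if "r \<in> S" for r
    using v(2) u(2) that by (simp add: cinner_simps diff_diff_eq[symmetric])
  moreover have "cinner I s (x - ?y) = 0"
  proof -
    \<comment> \<open>Orthogonality extends from \<open>S\<close> to its span, which contains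
      \<open>u\<close>; testing against \<open>s\<close> is then the same as testing against
      \<open>?s\<close>.\<close>
    have "cvec.span S \<subseteq> {z. cinner I z (x - ?y) = 0}"
      by (intro cvec.span_minimal)
        (use S in \<open>auto simp: cvec.subspace_def cinner_simps(1,5,7)\<close>)
    then have "cinner I s (x - ?y) = cinner I ?s (x - ?y)"
      using u(1) by (auto simp: cinner_simps(3))
    also have "\<dots> = cinner I ?s (x - v) - c * cinner I ?s ?s"
      by (simp add: cinner_simps(2,4,6) algebra_simps)
    also have "\<dots> = 0"
    proof (cases "cinner I ?s ?s = 0")
      case True
      then have "?s = 0" using cinner_self_eq_0_iff[OF assms(1) s] by simp
      then show ?thesis by (simp add: cinner_simps(7))
    qed (simp add: c_def)
    finally show ?thesis .
  qed
  ultimately show ?case by blast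
qed

lemma supp_subspace: "X \<in> operators I \<Longrightarrow> subspace_of I (supp I X)"
proof -
  have "vscale c (op_apply I X v) \<in> supp I X" if "v \<in> vectors I" for c v
    unfolding supp_def by (rule image_eqI[of _ _ "vscale c v"]) (auto simp: op_apply_simps vectors_vscale that)
  moreover have "op_apply I X v + op_apply I X w \<in> supp I X" if "v \<in> vectors I" "w \<in> vectors I" for v w
    unfolding supp_def by (rule image_eqI[of _ _ "v + w"]) (auto simp: op_apply_simps vectors_add that)
  moreover have "0 \<in> supp I X"
    unfolding supp_def by (rule image_eqI[of _ _ 0]) (auto simp: op_apply_def vectors_0)
  moreover assume "X \<in> operators I"
  ultimately show ?thesis
    by (auto simp: subspace_of_def cvec.subspace_def vectors_op_apply supp_def)
qed

text \<open>The range of a hermitian operator is the orthogonal complement of its kernel. Projecting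
  \<open>x\<close> onto the span of the columns leaves a remainder in the kernel; it is orthogonal
  to \<open>x\<close> and to the range, hence zero.\<close>

lemma in_suppI:
  assumes "finite I" "positive I X" "x \<in> vectors I"
    and perp: "\<And>w. w \<in> vectors I \<Longrightarrow> op_apply I X w = 0 \<Longrightarrow> cinner I x w = 0"
  shows "x \<in> supp I X"
proof -
  let ?S = "(\<lambda>i. op_apply I X (ket i)) ` I"
  have op: "X \<in> operators I" using assms(2) by (rule positive_operators)
  obtain v where v: "v \<in> cvec.span ?S" and orth: "\<forall>s\<in>?S. cinner I s (x - v) = 0"
    using orthogonal_projection_ex[of I ?S x] assms(1,3) vectors_op_apply[OF op] by blast
  have "?S \<subseteq> supp I X" by (auto simp: supp_def vectors_ket)
  then have "cvec.span ?S \<subseteq> supp I X"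
    using supp_subspace[OF op] by (intro cvec.span_minimal) (auto simp: subspace_of_def)
  then have vs: "v \<in> supp I X" using v by blast
  then obtain u where u: "u \<in> vectors I" "v = op_apply I X u" by (auto simp: supp_def)
  have vv: "v \<in> vectors I" using u op by (simp add: vectors_op_apply)
  let ?r = "x - v"
  have r: "?r \<in> vectors I" by (intro vectors_diff assms vv)
  have Xr: "op_apply I X ?r = 0"
  proof (rule vectors_eqI[of _ I])
    fix i assume i: "i \<in> I"
    have "op_apply I X ?r i = cinner I (ket i) (op_apply I X ?r)"
      by (simp add: cinner_ket assms(1) i)
    also have "\<dots> = cinner I (op_apply I X (ket i)) ?r"
      by (intro positive_adjoint[OF assms(2)] vectors_ket i r)
    finally show "op_apply I X ?r i = 0 i" using orth i by simp
  qed (use op in \<open>auto simp: vectors_op_apply vectors_0\<close>)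
  have "cinner I ?r ?r = cinner I x ?r - cinner I u (op_apply I X ?r)"
    using positive_adjoint[OF assms(2) u(1) r] by (simp only: u(2) cinner_simps(3))
  also have "\<dots> = 0" using perp[OF r Xr] by (simp add: Xr cinner_simps)
  finally have "x = v" using cinner_self_eq_0_iff[OF assms(1) r] by simp
  then show ?thesis using vs by simp
qed

text \<open>An injective map sends a basis of \<open>V\<close> to \<open>dim W\<close> independent
  vectors of \<open>W\<close>; a vector of \<open>W\<close> outside their span would give an
  independent set larger than the spanning set \<open>C\<close>.\<close>

lemma cvec_linear_image_eq:
  fixes T :: "'i vector \<Rightarrow> 'j vector"
  assumes lin: "\<And>u v. T (u + v) = T u + T v" "\<And>c v. T (vscale c v) = vscale c (T v)"
    and sub: "cvec.subspace V" "cvec.subspace W" and TV: "T ` V \<subseteq> W"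
    and inj: "\<And>v. v \<in> V \<Longrightarrow> T v = 0 \<Longrightarrow> v = 0"
    and dim: "cvec.dim V = cvec.dim W" "cvec.dim W > 0"
  shows "T ` V = W"
proof -
  interpret T: Vector_Spaces.linear vscale vscale T
    by (intro Vector_Spaces.linear_iff[THEN iffD2] conjI allI lin cvec.vector_space_axioms)
  obtain B where B: "B \<subseteq> V" "cvec.independent B" "V \<subseteq> cvec.span B" "card B = cvec.dim V"
    using cvec.basis_exists by blast
  obtain C where C: "C \<subseteq> W" "W \<subseteq> cvec.span C" "card C = cvec.dim W"
    using cvec.basis_exists by metis
  have span_B: "cvec.span B = V" using B(1,3) sub(1) by (rule cvec.span_subspace)
  have inj_V: "inj_on T (cvec.span B)"
    unfolding T.inj_on_iff_eq_0[OF cvec.subspace_span] using inj span_B by blast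
  then have ind: "cvec.independent (T ` B)"
    by (rule T.independent_inj_on_image[OF B(2)])
  have "inj_on T B" using inj_V by (rule inj_on_subset) (rule cvec.span_superset)
  then have card: "card (T ` B) = card C" using B(4) C(3) dim(1) by (simp add: card_image)
  \<comment> \<open>\<open>card\<close> is 0 on infinite sets, so a positive dimension makes both
    sets finite.\<close>
  have finC: "finite C" using C(3) dim(2) by (simp add: card_ge_0_finite)
  have finB: "finite (T ` B)" using card C(3) dim(2) by (metis card_ge_0_finite)
  have TBW: "T ` B \<subseteq> W" using TV B(1) by blast
  have "W \<subseteq> T ` V"
  proof (rule ccontr)
    assume "\<not> W \<subseteq> T ` V"
    then obtain w where w: "w \<in> W" "w \<notin> cvec.span (T ` B)"
      using T.span_image[of B] span_B by auto
    then have "cvec.independent (insert w (T ` B))"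
      using ind by (intro cvec.independent_insertI)
    then have "card (insert w (T ` B)) \<le> card C"
      using cvec.independent_span_bound[OF finC] w(1) TBW C(2) by blast
    moreover have "w \<notin> T ` B" using w(2) cvec.span_base by blast
    ultimately show False using card finB by simp
  qed
  with TV show ?thesis by blast
qed

section \<open>Nonnegative sums and the trace bound\<close>

lemma sum_nonneg_Reals_eq_0:
  fixes f :: "'k \<Rightarrow> complex"
  assumes "finite K" "\<And>k. k \<in> K \<Longrightarrow> f k \<in> \<real>\<^sub>\<ge>\<^sub>0" "sum f K = 0" "k \<in> K"
  shows "f k = 0"
proof -
  have "(\<Sum>k\<in>K. Re (f k)) = 0" using assms(3) by (metis Re_sum zero_complex.sel(1))
  then have "Re (f k) = 0"
    using assms(1,2,4) by (subst (asm) sum_nonneg_eq_0_iff) (auto simp: complex_nonneg_Reals_iff)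
  then show ?thesis
    using assms(2)[OF assms(4)] by (simp add: complex_nonneg_Reals_iff complex_eq_iff)
qed

lemma sum_nonneg_Reals:
  fixes f :: "'k \<Rightarrow> complex"
  assumes "\<And>k. k \<in> K \<Longrightarrow> f k \<in> \<real>\<^sub>\<ge>\<^sub>0"
  shows "sum f K \<in> \<real>\<^sub>\<ge>\<^sub>0"
  using assms by (induction K rule: infinite_finite_induct) (auto intro: nonneg_Reals_add_I)

lemma positive_outer: "v \<in> vectors I \<Longrightarrow> positive I (outer v v)"
proof (intro positiveI operators_outer)
  fix w
  have "cinner I w (op_apply I (outer v v) w) = of_real ((cmod (cinner I v w))\<^sup>2)"
    using cinner_commute[of I w v] by (simp add: cinner_outer complex_norm_square mult.commute flip: of_real_power)
  then show "cinner I w (op_apply I (outer v v) w) \<in> \<real>\<^sub>\<ge>\<^sub>0" by simp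
qed

lemma cinner_op_apply_sum:
  "cinner I v (op_apply I (\<Sum>k\<in>K. X k) w) = (\<Sum>k\<in>K. cinner I v (op_apply I (X k) w))"
proof -
  have "cinner I v (op_apply I 0 w) = 0" by (simp add: cinner_op_apply)
  then show ?thesis
    by (induction K rule: infinite_finite_induct) (simp_all add: cinner_op_apply_lin)
qed

lemma op_trace_outer: "op_trace I (outer v w) = cinner I w v"
  by (simp add: op_trace_def outer_def cinner_def mult.commute)

lemma op_trace_sum: "op_trace I (\<Sum>k\<in>K. X k) = (\<Sum>k\<in>K. op_trace I (X k))"
  unfolding op_trace_def by (subst sum.swap) (simp add: sum_fun_app)

lemma nonneg_cinner_self: "cinner I v v \<in> \<real>\<^sub>\<ge>\<^sub>0"
  by (simp add: cinner_self sum_nonneg del: of_real_sum)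

text \<open>A positive operator lies below its trace times the identity. A rank-one decomposition
  reduces this to Cauchy-Schwarz for each term. It serves to show that the complement of an effect
  is positive.\<close>

lemma positive_trace_bound:
  assumes "finite I" "positive I X" "v \<in> vectors I"
  shows "cinner I v v * op_trace I X - cinner I v (op_apply I X v) \<in> \<real>\<^sub>\<ge>\<^sub>0"
proof -
  obtain t where t: "X = (\<Sum>k\<in>I. outer (t k) (t k))"
    using positive_decomposition[OF assms(1,2)] by blast
  have CS: "cinner I v v * cinner I u u - cinner I v u * cinner I u v \<in> \<real>\<^sub>\<ge>\<^sub>0" for u
  proof (cases "v = 0")
    case True
    then show ?thesis by (simp add: cinner_simps)
  next
    case False
    define r where "r = (\<Sum>x\<in>I. (cmod (v x))\<^sup>2)"
    have r: "cinner I v v = of_real r" "r \<ge> 0"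
      by (simp_all add: cinner_self r_def sum_nonneg)
    have "r \<noteq> 0" using r False cinner_self_eq_0_iff[OF assms(1,3)] by auto
    \<comment> \<open>\<open>?w\<close> is the part of \<open>u\<close> orthogonal to
      \<open>v\<close>; its squared norm, times \<open>r\<close>, is the Cauchy-Schwarz gap.\<close>
    let ?w = "u - vscale (cinner I v u / of_real r) v"
    have "of_real r * cinner I ?w ?w = cinner I v v * cinner I u u - cinner I v u * cinner I u v"
      using \<open>r \<noteq> 0\<close> cinner_commute[of I v u] by (simp add: cinner_simps r field_simps)
    moreover have "of_real r * cinner I ?w ?w \<in> \<real>\<^sub>\<ge>\<^sub>0"
      using r(2) nonneg_cinner_self by (intro nonneg_Reals_mult_I) auto
    ultimately show ?thesis by simp
  qed
  have "cinner I v v * op_trace I X - cinner I v (op_apply I X v) =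
      (\<Sum>k\<in>I. cinner I v v * cinner I (t k) (t k) - cinner I v (t k) * cinner I (t k) v)"
    unfolding t op_trace_sum cinner_op_apply_sum op_trace_outer cinner_outer
    by (simp add: sum_distrib_left sum_subtractf)
  then show ?thesis using CS by (simp add: sum_nonneg_Reals)
qed

subsection \<open>Channels\<close>

text \<open>Relabelling the basis leaves the quadratic form unchanged. This moves positivity between
  systems that differ only in their index sets, such as reference systems and the two bracketings of
  a triple product; the \<open>if\<close> restores the convention that entries off the basis
  vanish.\<close>

lemma positive_reindex:
  assumes f: "bij_betw f J I" and X: "positive I X"
  shows "positive J (\<lambda>x y. if x \<in> J \<and> y \<in> J then X (f x) (f y) else 0)" (is "positive J ?Y")
proof (intro positiveI)
  fix v assume "v \<in> vectors J"
  let ?w = "\<lambda>x. if x \<in> I then v (inv_into J f x) else 0"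
  have w: "?w (f x) = v x" if "x \<in> J" for x
    using f that by (auto simp: bij_betw_def)
  have "cinner J v (op_apply J ?Y v) = (\<Sum>x\<in>J. \<Sum>y\<in>J. cnj (?w (f x)) * X (f x) (f y) * ?w (f y))"
    unfolding cinner_op_apply by (intro sum.cong refl) (simp add: w del: if_cancel)
  also have "\<dots> = (\<Sum>x\<in>J. \<Sum>y\<in>I. cnj (?w (f x)) * X (f x) y * ?w y)"
    by (intro sum.cong refl sum.reindex_bij_betw[OF f])
  also have "\<dots> = cinner I ?w (op_apply I X ?w)"
    unfolding cinner_op_apply by (rule sum.reindex_bij_betw[OF f])
  also have "\<dots> \<in> \<real>\<^sub>\<ge>\<^sub>0"
    by (intro positive_cinner[OF X]) (simp add: vectors_def)
  finally show "cinner J v (op_apply J ?Y v) \<in> \<real>\<^sub>\<ge>\<^sub>0" .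
qed (auto simp: operators_def)

lemma channel_operators: "channel I J \<Phi> \<Longrightarrow> X \<in> operators I \<Longrightarrow> \<Phi> X \<in> operators J"
  and channel_add: "channel I J \<Phi> \<Longrightarrow> X \<in> operators I \<Longrightarrow> Y \<in> operators I \<Longrightarrow> \<Phi> (X + Y) = \<Phi> X + \<Phi> Y"
  and channel_scale: "channel I J \<Phi> \<Longrightarrow> X \<in> operators I \<Longrightarrow> \<Phi> (op_scale c X) = op_scale c (\<Phi> X)"
  and channel_trace: "channel I J \<Phi> \<Longrightarrow> X \<in> operators I \<Longrightarrow> op_trace J (\<Phi> X) = op_trace I X"
  by (auto simp: channel_def)

lemma channel_0:
  assumes "channel I J \<Phi>"
  shows "\<Phi> 0 = 0"
proof -
  have "\<Phi> (op_scale 0 0) = op_scale 0 (\<Phi> 0)"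
    by (rule channel_scale[OF assms]) (simp add: operators_def)
  then show ?thesis by (simp add: op_scale_def zero_fun_def)
qed

lemma channel_sum:
  assumes "channel I J \<Phi>" "\<And>k. k \<in> K \<Longrightarrow> X k \<in> operators I"
  shows "\<Phi> (\<Sum>k\<in>K. op_scale (c k) (X k)) = (\<Sum>k\<in>K. op_scale (c k) (\<Phi> (X k)))"
  using assms(2)
  by (induction K rule: infinite_finite_induct)
    (simp_all add: channel_0[OF assms(1)] channel_add[OF assms(1)] channel_scale[OF assms(1)]
      operators_op_scale operators_sum)

text \<open>Complete positivity is stated for reference systems \<open>{..<k}\<close> only.\<close>

lemma positive_id_tensor:
  fixes K :: "'k set" and I :: "'i set" and J :: "'j set"
  assumes "finite K" "channel I J \<Phi>" "positive (K \<times> I) X"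
  shows "positive (K \<times> J) (id_tensor \<Phi> X)"
proof -
  define k where "k = card K"
  obtain h where h: "bij_betw h {..<k} K"
    using ex_bij_betw_nat_finite[OF assms(1)] by (auto simp: k_def atLeast0LessThan)
  let ?g = "inv_into {..<k} h"
  have g: "bij_betw ?g K {..<k}" using h by (rule bij_betw_inv_into)
  let ?h = "map_prod h (id :: 'i \<Rightarrow> 'i)"
  let ?g' = "map_prod ?g (id :: 'j \<Rightarrow> 'j)"
  \<comment> \<open>\<open>X\<close> with its reference system renamed to \<open>{..<k}\<close>;
    complete positivity applies to it, and the result is renamed back through
    \<open>?g'\<close>.\<close>
  define X' where "X' = (\<lambda>x y. if x \<in> {..<k} \<times> I \<and> y \<in> {..<k} \<times> I then X (?h x) (?h y) else 0)"
  have "positive ({..<k} \<times> I) X'"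
    unfolding X'_def by (rule positive_reindex[OF bij_betw_map_prod[OF h bij_betw_id] assms(3)])
  then have "positive ({..<k} \<times> J) (id_tensor \<Phi> X')"
    using assms(2) by (simp add: channel_def completely_positive_def)
  from positive_reindex[OF bij_betw_map_prod[OF g bij_betw_id] this]
  have "positive (K \<times> J) (\<lambda>x y. if x \<in> K \<times> J \<and> y \<in> K \<times> J
      then id_tensor \<Phi> X' (?g' x) (?g' y) else 0)"
    .
  also have "(\<lambda>x y. if x \<in> K \<times> J \<and> y \<in> K \<times> J then id_tensor \<Phi> X' (?g' x) (?g' y) else 0) = id_tensor \<Phi> X"
  proof (intro ext)
    fix x y :: "'k \<times> 'j"
    obtain r b s c where xy: "x = (r, b)" "y = (s, c)" by (cases x; cases y)
    have XO: "X (r, u) (s, v) = 0" if "r \<notin> K \<or> s \<notin> K \<or> u \<notin> I \<or> v \<notin> I" for u v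
      using positive_operators[OF assms(3)] that by (auto simp: operators_def)
    have op: "(\<lambda>u v. X (r, u) (s, v)) \<in> operators I"
      using XO by (auto simp: operators_def)
    show "(if x \<in> K \<times> J \<and> y \<in> K \<times> J then id_tensor \<Phi> X' (?g' x) (?g' y) else 0) = id_tensor \<Phi> X x y"
    proof (cases "r \<in> K \<and> s \<in> K")
      case True
      then have gk: "?g r < k" "?g s < k" and hg: "h (?g r) = r" "h (?g s) = s"
        using g h by (auto simp: bij_betw_def f_inv_into_f)
      have "(\<lambda>u v. X' (?g r, u) (?g s, v)) = (\<lambda>u v. X (r, u) (s, v))"
        using XO by (auto simp: X'_def gk hg fun_eq_iff)
      then show ?thesis
        using True channel_operators[OF assms(2) op]
        by (auto simp: xy id_tensor_def operators_def)
    next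
      case False
      then have "(\<lambda>u v. X (r, u) (s, v)) = 0" using XO by (auto simp: fun_eq_iff)
      then show ?thesis using False channel_0[OF assms(2)] by (auto simp: xy id_tensor_def)
    qed
  qed
  finally show ?thesis .
qed

text \<open>Complete positivity with a one-dimensional reference system, here labelled by
  \<open>()\<close>.\<close>

lemma channel_positive:
  assumes "channel I J \<Phi>" "positive I X"
  shows "positive J (\<Phi> X)"
proof -
  let ?X = "\<lambda>x y. if x \<in> {()} \<times> I \<and> y \<in> {()} \<times> I then X (snd x) (snd y) else 0"
  have "positive ({()} \<times> I) ?X"
    using assms(2) by (intro positive_reindex) (auto simp: bij_betw_def inj_on_def)
  then have "positive ({()} \<times> J) (id_tensor \<Phi> ?X)"
    using assms(1) by (intro positive_id_tensor) auto
  then have *: "positive J (\<lambda>x y. if x \<in> J \<and> y \<in> J then id_tensor \<Phi> ?X ((), x) ((), y) else 0)"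
    by (intro positive_reindex) (auto simp: bij_betw_def inj_on_def)
  have "(\<lambda>u v. ?X ((), u) ((), v)) = X"
    using positive_operators[OF assms(2)] by (auto simp: operators_def fun_eq_iff)
  then have "(\<lambda>x y. if x \<in> J \<and> y \<in> J then id_tensor \<Phi> ?X ((), x) ((), y) else 0) = \<Phi> X"
    using channel_operators[OF assms(1) positive_operators[OF assms(2)]]
    by (auto simp: operators_def fun_eq_iff id_tensor_def)
  with * show ?thesis by simp
qed

subsection \<open>Erasure correction\<close>

text \<open>The component \<open>(<a| \<otimes> 1) v\<close>; the slices of a vector are its images
  under the Kraus operators of the erasure of \<open>A\<close>.\<close>

definition slice :: "('a \<times> 'j) vector \<Rightarrow> 'a \<Rightarrow> 'j vector" where
  "slice v a = (\<lambda>y. v (a, y))"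

text \<open>The partial inner product \<open>(\<langle>m| \<otimes> 1) v\<close>.\<close>

definition contract :: "'a set \<Rightarrow> 'a vector \<Rightarrow> ('a \<times> 'j) vector \<Rightarrow> 'j vector" where
  "contract A m v = (\<lambda>y. \<Sum>a\<in>A. cnj (m a) * v (a, y))"

lemma contract_simps:
  "contract A m (u + v) = contract A m u + contract A m v"
  "contract A m (u - v) = contract A m u - contract A m v"
  "contract A m (vscale c v) = vscale c (contract A m v)"
  "contract A m 0 = 0"
  "contract A (m - m') v = contract A m v - contract A m' v"
  "contract A (vscale c m) v = vscale (cnj c) (contract A m v)"
  by (simp_all add: contract_def vscale_def fun_eq_iff algebra_simps sum.distrib sum_subtractf
      sum_distrib_left)

lemma vectors_slice: "v \<in> vectors (A \<times> J) \<Longrightarrow> slice v a \<in> vectors J"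
  and vectors_contract: "v \<in> vectors (A \<times> J) \<Longrightarrow> contract A m v \<in> vectors J"
  by (auto simp: vectors_def slice_def contract_def)

lemma cinner_Times: "cinner (A \<times> J) v w = (\<Sum>a\<in>A. cinner J (slice v a) (slice w a))"
  by (simp add: cinner_def slice_def sum.cartesian_product)

text \<open>Contractions are combinations of slices, so orthogonality of all slices carries over to
  all contractions, whatever \<open>m\<close> and \<open>m'\<close> are.\<close>

lemma cinner_contract:
  "cinner J (contract A m v) (contract A m' w) =
    (\<Sum>a\<in>A. \<Sum>a'\<in>A. m a * cnj (m' a') * cinner J (slice v a) (slice w a'))"
proof -
  have "cinner J (contract A m v) (contract A m' w) =
      (\<Sum>y\<in>J. \<Sum>a\<in>A. \<Sum>a'\<in>A. m a * cnj (m' a') * (cnj (v (a, y)) * w (a', y)))"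
    by (simp add: cinner_def contract_def sum_product mult_ac)
  also have "\<dots> = (\<Sum>a\<in>A. \<Sum>y\<in>J. \<Sum>a'\<in>A. m a * cnj (m' a') * (cnj (v (a, y)) * w (a', y)))"
    by (rule sum.swap)
  also have "\<dots> = (\<Sum>a\<in>A. \<Sum>a'\<in>A. \<Sum>y\<in>J. m a * cnj (m' a') * (cnj (v (a, y)) * w (a', y)))"
    by (intro sum.cong refl sum.swap)
  finally show ?thesis by (simp add: cinner_def slice_def sum_distrib_left)
qed

lemma ptrace_fst_outer: "ptrace_fst A (outer v w) = (\<Sum>a\<in>A. outer (slice v a) (slice w a))"
  by (simp add: ptrace_fst_def outer_def slice_def fun_eq_iff sum_fun_app)

lemma op_apply_mult: "op_apply I (op_mult I X Y) v = op_apply I X (op_apply I Y v)"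
proof
  fix x
  have "op_apply I (op_mult I X Y) v x = (\<Sum>z\<in>I. \<Sum>y\<in>I. X x y * Y y z * v z)"
    by (simp add: op_apply_def op_mult_def sum_distrib_right)
  also have "\<dots> = (\<Sum>y\<in>I. \<Sum>z\<in>I. X x y * Y y z * v z)"
    by (rule sum.swap)
  finally show "op_apply I (op_mult I X Y) v x = op_apply I X (op_apply I Y v) x"
    by (simp add: op_apply_def sum_distrib_left mult.assoc)
qed

text \<open>\<open>P\<close> is hermitian and fixes \<open>v\<close>, so it acts trivially on both
  sides. The recovery identity thereby applies to the pure states of the code.\<close>

lemma compress_outer:
  assumes "orth_projector I V P" "v \<in> V"
  shows "compress I P (outer v v) = outer v v"
proof -
  obtain u where u: "v = op_apply I P u" using assms by (auto simp: orth_projector_def supp_def)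
  have "op_apply I P v = v"
    using assms(1) op_apply_mult[of I P P u] by (simp add: orth_projector_def u)
  then have Pv: "(\<Sum>y\<in>I. P x y * v y) = v x" for x
    by (simp add: op_apply_def fun_eq_iff)
  have P_cnj: "cnj (P x y) = P y x" for x y
  proof -
    have "op_adjoint P y x = P y x" using assms(1) by (simp add: orth_projector_def)
    then show ?thesis by (simp add: op_adjoint_def)
  qed
  have vP: "(\<Sum>y\<in>I. cnj (v y) * P y x) = cnj (v x)" for x
    using arg_cong[OF Pv[of x], of cnj] by (simp add: P_cnj mult.commute)
  have "op_mult I P (outer v v) = outer v v"
    by (simp add: op_mult_def outer_def fun_eq_iff Pv flip: mult.assoc sum_distrib_right)
  moreover have "op_mult I (outer v v) P = outer v v"
    by (simp add: op_mult_def outer_def fun_eq_iff mult.assoc vP flip: sum_distrib_left)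
  ultimately show ?thesis by (simp add: compress_def)
qed

text \<open>The Knill--Laflamme condition for the erasure of \<open>A\<close>.\<close>

lemma contract_inner_scalar:
  assumes fin: "finite A" "finite J" and V: "subspace_of (A \<times> J) V"
    and orth: "\<And>v v' a a'. v \<in> V \<Longrightarrow> v' \<in> V \<Longrightarrow> cinner (A \<times> J) v v' = 0 \<Longrightarrow>
      a \<in> A \<Longrightarrow> a' \<in> A \<Longrightarrow> cinner J (slice v a) (slice v' a') = 0"
  shows "\<exists>c. \<forall>v\<in>V. \<forall>w\<in>V.
    cinner J (contract A m v) (contract A m' w) = c * cinner (A \<times> J) v w"
proof (cases "\<exists>e\<in>V. e \<noteq> 0")
  case False
  then show ?thesis by (intro exI[of _ 0]) (auto simp: contract_simps cinner_simps)
next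
  case True
  then obtain e where e: "e \<in> V" "e \<noteq> 0" by blast
  let ?i = "cinner (A \<times> J)"
  let ?g = "\<lambda>v w. cinner J (contract A m v) (contract A m' w)"
  have g: "?g v w = 0" if "v \<in> V" "w \<in> V" "?i v w = 0" for v w
    unfolding cinner_contract using orth[OF that] by simp
  note g_simps = contract_simps cinner_simps
  have mem: "u \<in> V \<Longrightarrow> w \<in> V \<Longrightarrow> u + w \<in> V" "u \<in> V \<Longrightarrow> w \<in> V \<Longrightarrow> u - w \<in> V"
    "u \<in> V \<Longrightarrow> vscale b u \<in> V" for u w b
    using V by (auto simp: subspace_of_def intro: cvec.subspace_add cvec.subspace_diff cvec.subspace_scale)
  have nz: "?i v v \<noteq> 0" if "v \<in> V" "v \<noteq> 0" for v
  proof -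
    have "v \<in> vectors (A \<times> J)" using that V by (auto simp: subspace_of_def)
    then show ?thesis using that fin by (simp add: cinner_self_eq_0_iff)
  qed
  \<comment> \<open>The constant is read off at one nonzero vector \<open>e\<close>; what remains is
    that every other vector gives the same ratio.\<close>
  define c where "c = ?g e e / ?i e e"
  have perp: "?g u u = c * ?i u u" if u: "u \<in> V" and eu: "?i e u = 0" for u
  proof -
    \<comment> \<open>\<open>r\<close> gives \<open>r e\<close> the length of \<open>u\<close>, so
      that \<open>u + r e\<close> and \<open>u - r e\<close> are orthogonal. As \<open>?g\<close>
      vanishes on orthogonal pairs, comparing the diagonal terms equates the two ratios.\<close>
    define r where "r = sqrt ((\<Sum>x\<in>A \<times> J. (cmod (u x))\<^sup>2) / (\<Sum>x\<in>A \<times> J. (cmod (e x))\<^sup>2))"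
    have r: "of_real r * of_real r * ?i e e = ?i u u"
    proof -
      have "r * r = (\<Sum>x\<in>A \<times> J. (cmod (u x))\<^sup>2) / (\<Sum>x\<in>A \<times> J. (cmod (e x))\<^sup>2)"
        by (simp add: r_def sum_nonneg)
      then have "complex_of_real r * of_real r = ?i u u / ?i e e"
        by (simp only: cinner_self flip: of_real_mult of_real_divide)
      then show ?thesis using nz[OF e] by simp
    qed
    have ue: "?i u e = 0" using eu cinner_commute[of "A \<times> J" u e] by simp
    let ?x = "u + vscale (of_real r) e" and ?y = "u - vscale (of_real r) e"
    have "?i ?x ?y = 0" using r by (simp add: cinner_simps eu ue mult.assoc)
    then have "?g ?x ?y = 0" by (intro g[OF mem(1) mem(2)] mem(3) u e)
    moreover have "?g e u = 0" "?g u e = 0" using eu ue by (auto intro: g u e)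
    ultimately have "?g u u = of_real r * of_real r * ?g e e" by (simp add: g_simps)
    also have "\<dots> = c * ?i u u" using nz[OF e] by (simp add: c_def flip: r)
    finally show ?thesis .
  qed
  have diag: "?g v v = c * ?i v v" if v: "v \<in> V" for v
  proof -
    \<comment> \<open>Splitting \<open>v\<close> into a multiple of \<open>e\<close> and a part
      \<open>u\<close> orthogonal to \<open>e\<close>, to which \<open>perp\<close> applies.\<close>
    define b where "b = ?i e v / ?i e e"
    define u where "u = v - vscale b e"
    have u: "u \<in> V" unfolding u_def by (intro mem(2,3) v e)
    have eu: "?i e u = 0" using nz[OF e] by (simp add: u_def b_def cinner_simps)
    then have ue: "?i u e = 0" using cinner_commute[of "A \<times> J" u e] by simp
    have "v = u + vscale b e" by (simp add: u_def)
    moreover have "?g (u + vscale b e) (u + vscale b e) = c * ?i (u + vscale b e) (u + vscale b e)"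
      using perp[OF u eu] g[OF e(1) u eu] g[OF u e(1) ue] nz[OF e]
      by (simp add: g_simps eu ue c_def field_simps)
    ultimately show ?thesis by simp
  qed
  have "?g v w = c * ?i v w" if v: "v \<in> V" and w: "w \<in> V" for v w
  proof (cases "v = 0")
    case True
    then show ?thesis by (simp add: g_simps)
  next
    case False
    define b where "b = ?i v w / ?i v v"
    define u where "u = w - vscale b v"
    have u: "u \<in> V" unfolding u_def by (intro mem(2,3) v w)
    have vu: "?i v u = 0" using nz[OF v False] by (simp add: u_def b_def cinner_simps)
    have "w = u + vscale b v" by (simp add: u_def)
    moreover have "?g v (u + vscale b v) = c * ?i v (u + vscale b v)"
      using g[OF v u vu] diag[OF v] by (simp add: g_simps vu)
    ultimately show ?thesis by simp
  qed
  then show ?thesis by blast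
qed

text \<open>A shared nonzero vector makes the two contractions proportional on \<open>V\<close>.
  Subtracting a suitable multiple of \<open>m'\<close> from \<open>m\<close> leaves a
  \<open>k\<close> whose image is orthogonal to that of \<open>m'\<close>. Its value at
  \<open>v\<close> also lies in the image of \<open>m'\<close>, so it is 0, and a multiple of an
  isometry that kills a nonzero vector kills all of \<open>V\<close>.\<close>

lemma contract_images_eq:
  assumes fin: "finite A" "finite J" and V: "subspace_of (A \<times> J) V"
    and KL: "\<And>m m'. \<exists>c. \<forall>v\<in>V. \<forall>w\<in>V.
      cinner J (contract A m v) (contract A m' w) = c * cinner (A \<times> J) v w"
    and v: "v \<in> V" "v' \<in> V" and eq: "contract A m v = contract A m' v'" and nz: "contract A m v \<noteq> 0"
  shows "contract A m ` V = contract A m' ` V"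
proof -
  have vec: "contract A k u \<in> vectors J" if "u \<in> V" for u k
    using that V by (auto simp: subspace_of_def intro: vectors_contract)
  obtain c1 where "\<forall>u\<in>V. \<forall>w\<in>V.
      cinner J (contract A m u) (contract A m' w) = c1 * cinner (A \<times> J) u w"
    using KL[of m m'] ..
  note c1 = this[rule_format]
  obtain c2 where "\<forall>u\<in>V. \<forall>w\<in>V.
      cinner J (contract A m' u) (contract A m' w) = c2 * cinner (A \<times> J) u w"
    using KL[of m' m'] ..
  note c2 = this[rule_format]
  have "cinner J (contract A m' v') (contract A m' v') \<noteq> 0"
    using nz by (simp add: eq cinner_self_eq_0_iff[OF fin(2) vec[OF v(2)]])
  then have "c2 \<noteq> 0" using c2[OF v(2) v(2)] by auto
  \<comment> \<open>The ratio that makes \<open>c1 - z * c2\<close> vanish, the factor of the inner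
    products between the images of \<open>k\<close> and \<open>m'\<close>. Since
    \<open>contract\<close> is conjugate-linear in \<open>m\<close>, it appears below as
    \<open>cnj z\<close>.\<close>
  define z where "z = c1 / c2"
  define k where "k = m - vscale z m'"
  have k: "contract A k u = contract A m u - vscale (cnj z) (contract A m' u)" for u
    by (simp add: k_def contract_simps)
  obtain c3 where "\<forall>u\<in>V. \<forall>w\<in>V.
      cinner J (contract A k u) (contract A k w) = c3 * cinner (A \<times> J) u w"
    using KL[of k k] ..
  note c3 = this[rule_format]
  have orth: "cinner J (contract A k u) (contract A m' w) = 0" if "u \<in> V" "w \<in> V" for u w
    using \<open>c2 \<noteq> 0\<close> that by (simp add: k cinner_simps c1 c2 z_def)
  have Vm: "u \<in> V \<Longrightarrow> vscale b u \<in> V" "u \<in> V \<Longrightarrow> w \<in> V \<Longrightarrow> u - w \<in> V" for b u w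
    using V by (auto simp: subspace_of_def intro: cvec.subspace_diff cvec.subspace_scale)
  have "contract A k v = contract A m' (v' - vscale (cnj z) v)"
    by (simp add: k contract_simps eq)
  then have "cinner J (contract A k v) (contract A k v) = 0"
    using orth[OF v(1) Vm(2)[OF v(2) Vm(1)[OF v(1), of "cnj z"]]] by simp
  moreover have "cinner (A \<times> J) v v \<noteq> 0"
  proof -
    have "v \<in> vectors (A \<times> J)" "v \<noteq> 0" using v nz V by (auto simp: subspace_of_def contract_simps)
    then show ?thesis using fin by (simp add: cinner_self_eq_0_iff)
  qed
  ultimately have "c3 = 0" using c3[OF v(1) v(1)] by simp
  then have "contract A k u = 0" if "u \<in> V" for u
    using c3[OF that that] cinner_self_eq_0_iff[OF fin(2) vec[OF that]] by simp
  then have m: "contract A m u = contract A m' (vscale (cnj z) u)" if "u \<in> V" for u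
    using that k[of u] by (simp add: contract_simps)
  \<comment> \<open>If \<open>z\<close> were 0, the contraction by \<open>m\<close> would vanish at
    \<open>v\<close>. The proportionality can thus be inverted, which gives the other
    inclusion.\<close>
  have "z \<noteq> 0"
    using m[OF v(1)] nz by (auto simp: vscale_def zero_fun_def contract_def)
  then have m': "contract A m' u = contract A m (vscale (1 / cnj z) u)" if "u \<in> V" for u
    using m[OF Vm(1)[OF that, of "1 / cnj z"]] \<open>z \<noteq> 0\<close> by simp
  show ?thesis
    using Vm(1) by (intro equalityI image_subsetI) (auto intro!: image_eqI[where f = "contract A m'", OF m] image_eqI[where f = "contract A m", OF m'])
qed

text \<open>
  A channel cannot create orthogonality: the functional \<open>X \<mapsto> \<langle>v| R X |v\<rangle>\<close> is represented by an
  effect \<open>F\<close> that accepts the image of \<open>v\<close> and rejects the image of \<open>v'\<close> with certainty.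
\<close>

lemma erasure_code_slice_orthogonal:
  assumes fin: "finite A" "finite J" and code: "erasure_code A J Q V"
    and v: "v \<in> V" and v': "v' \<in> V" and orth: "cinner (A \<times> J) v v' = 0"
    and a: "a \<in> A" and a': "a' \<in> A"
  shows "cinner J (slice v a) (slice v' a') = 0"
proof (cases "v = 0")
  case True
  then show ?thesis by (simp add: slice_def cinner_def)
next
  case False
  let ?AJ = "A \<times> J"
  have finAJ: "finite ?AJ" using fin by simp
  obtain P R where P: "orth_projector ?AJ V P" and R: "channel J ?AJ R"
    and rec: "\<And>X. X \<in> operators ?AJ \<Longrightarrow> R (ptrace_fst A (compress ?AJ P X)) = compress ?AJ P X"
    using code by (auto simp: erasure_code_def)
  have V: "V \<subseteq> vectors ?AJ" using code by (simp add: erasure_code_def subspace_of_def)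
  have vV: "v \<in> vectors ?AJ" "v' \<in> vectors ?AJ" using v v' V by auto
  have rec_outer: "R (\<Sum>a\<in>A. outer (slice u a) (slice u a)) = outer u u" if "u \<in> V" for u
  proof -
    have "outer u u \<in> operators ?AJ" using that V by (intro operators_outer) auto
    from rec[OF this] show ?thesis
      using that by (simp add: compress_outer[OF P] ptrace_fst_outer)
  qed
  define n where "n = cinner ?AJ v v"
  have n: "n \<noteq> 0" using False cinner_self_eq_0_iff[OF finAJ vV(1)] by (simp add: n_def)
  define f where "f = (\<lambda>X. cinner ?AJ v (op_apply ?AJ (R X) v))"
  \<comment> \<open>The image of \<open>outer v v\<close> under the adjoint of \<open>R\<close>. The
    kets are swapped so that the quadratic form of \<open>F\<close> at \<open>x\<close> is
    \<open>f (outer x x)\<close>.\<close>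
  define F where "F = (\<lambda>y z. if y \<in> J \<and> z \<in> J then f (outer (ket z) (ket y)) else 0)"
  \<comment> \<open>The complementary effect; \<open>n\<close> takes the place of 1 because
    \<open>v\<close> is not normalized. Its positivity will follow from trace preservation and
    \<open>positive_trace_bound\<close>.\<close>
  define G where "G = op_scale n (op_id J) - F"
  have F: "cinner J x (op_apply J F x) = f (outer x x)" if x: "x \<in> vectors J" for x
  proof -
    have "outer x x = (\<Sum>p\<in>J \<times> J. op_scale (cnj (x (fst p)) * x (snd p)) (outer (ket (snd p)) (ket (fst p))))"
      (is "_ = ?S")
    proof (rule operators_eqI[of _ J])
      show "?S \<in> operators J"
        by (intro operators_sum operators_op_scale operators_outer) (auto simp: vectors_ket)
      fix y z assume yz: "y \<in> J" "z \<in> J"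
      have "?S y z = (\<Sum>p\<in>J \<times> J. if p = (z, y) then cnj (x z) * x y else 0)"
        unfolding sum_fun_app by (intro sum.cong refl) (auto simp: op_scale_def outer_def ket_def)
      also have "\<dots> = outer x x y z"
        using fin yz by (simp add: outer_def mult.commute)
      finally show "outer x x y z = ?S y z" by simp
    qed (intro operators_outer x)
    then have "R (outer x x) =
        (\<Sum>p\<in>J \<times> J. op_scale (cnj (x (fst p)) * x (snd p)) (R (outer (ket (snd p)) (ket (fst p)))))"
      using channel_sum[OF R, of "J \<times> J" "\<lambda>p. outer (ket (snd p)) (ket (fst p))"]
      by (simp add: mem_Times_iff operators_outer vectors_ket)
    then have "f (outer x x) = (\<Sum>p\<in>J \<times> J. cnj (x (fst p)) * x (snd p) * f (outer (ket (snd p)) (ket (fst p))))"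
      by (simp add: f_def cinner_op_apply_sum cinner_op_apply_lin)
    also have "\<dots> = (\<Sum>y\<in>J. \<Sum>z\<in>J. cnj (x y) * F y z * x z)"
      by (simp add: F_def sum.cartesian_product' mult_ac)
    finally show ?thesis by (simp add: cinner_op_apply)
  qed
  have Fpos: "positive J F"
  proof (rule positiveI)
    fix x assume x: "x \<in> vectors J"
    then have "positive ?AJ (R (outer x x))" by (intro channel_positive[OF R] positive_outer)
    then show "cinner J x (op_apply J F x) \<in> \<real>\<^sub>\<ge>\<^sub>0"
      using positive_cinner vV(1) by (simp add: F[OF x] f_def)
  qed (simp add: F_def operators_def)
  have id: "cinner J x (op_apply J (op_id J) y) = cinner J x y" for x y :: "'b vector"
    using fin(2) by (simp add: cinner_def op_apply_def op_id_def if_distrib[of "\<lambda>c. c * _"] cong: if_cong)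
  have G: "cinner J x (op_apply J G x) = n * cinner J x x - f (outer x x)" if "x \<in> vectors J" for x
    by (simp add: G_def cinner_op_apply_lin id F[OF that])
  have Gpos: "positive J G"
  proof (rule positiveI)
    fix x assume x: "x \<in> vectors J"
    then have "positive ?AJ (R (outer x x))" by (intro channel_positive[OF R] positive_outer)
    from positive_trace_bound[OF finAJ this vV(1)]
    show "cinner J x (op_apply J G x) \<in> \<real>\<^sub>\<ge>\<^sub>0"
      using x by (simp add: G f_def n_def channel_trace[OF R] operators_outer op_trace_outer)
  qed (simp add: G_def F_def operators_def op_scale_def op_id_def)
  have sl: "slice u b \<in> vectors J" if "u \<in> V" for u b
    using that V by (auto intro: vectors_slice)
  \<comment> \<open>Recovery turns the erased state back into \<open>outer u u\<close>, so the sum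
    measures the overlap of \<open>u\<close> with \<open>v\<close>: it is 0 at \<open>v'\<close> and
    \<open>n * n\<close> at \<open>v\<close>.\<close>
  have fsum: "(\<Sum>b\<in>A. f (outer (slice u b) (slice u b))) = cinner ?AJ v u * cinner ?AJ u v"
    if u: "u \<in> V" for u
  proof -
    have "R (\<Sum>b\<in>A. outer (slice u b) (slice u b)) = (\<Sum>b\<in>A. R (outer (slice u b) (slice u b)))"
      using channel_sum[OF R, of A "\<lambda>b. outer (slice u b) (slice u b)" "\<lambda>_. 1"] sl[OF u]
      by (simp add: operators_outer op_scale_def)
    then have "(\<Sum>b\<in>A. f (outer (slice u b) (slice u b))) = cinner ?AJ v (op_apply ?AJ (outer u u) v)"
      by (simp add: f_def rec_outer[OF u] flip: cinner_op_apply_sum)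
    then show ?thesis by (simp add: cinner_outer)
  qed
  have "(\<Sum>b\<in>A. cinner J (slice v' b) (op_apply J F (slice v' b))) = 0"
    using fsum[OF v'] by (simp add: F sl v' orth)
  then have "cinner J (slice v' a') (op_apply J F (slice v' a')) = 0"
    using a' fin(1) positive_cinner[OF Fpos sl[OF v']]
      sum_nonneg_Reals_eq_0[of A "\<lambda>b. cinner J (slice v' b) (op_apply J F (slice v' b))" a'] by blast
  then have F0: "op_apply J F (slice v' a') = 0"
    by (intro positive_kernel[OF fin(2) Fpos] sl v')
  have "(\<Sum>b\<in>A. cinner J (slice v b) (op_apply J G (slice v b))) =
      n * cinner ?AJ v v - (\<Sum>b\<in>A. f (outer (slice v b) (slice v b)))"
    by (simp add: G sl v sum_subtractf cinner_Times sum_distrib_left)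
  then have "(\<Sum>b\<in>A. cinner J (slice v b) (op_apply J G (slice v b))) = 0"
    by (simp add: fsum[OF v] n_def)
  then have "cinner J (slice v a) (op_apply J G (slice v a)) = 0"
    using a fin(1) positive_cinner[OF Gpos sl[OF v]]
      sum_nonneg_Reals_eq_0[of A "\<lambda>b. cinner J (slice v b) (op_apply J G (slice v b))" a] by blast
  then have G0: "op_apply J G (slice v a) = 0"
    by (intro positive_kernel[OF fin(2) Gpos] sl v)
  \<comment> \<open>\<open>n\<close> times the identity is \<open>G + F\<close>; \<open>G\<close>
    annihilates the slice of \<open>v\<close> and \<open>F\<close> that of
    \<open>v'\<close>.\<close>
  have "n * cinner J (slice v a) (slice v' a') =
      cinner J (slice v a) (op_apply J G (slice v' a')) + cinner J (slice v a) (op_apply J F (slice v' a'))"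
    by (simp add: G_def cinner_op_apply_lin id)
  also have "\<dots> = 0"
    using positive_adjoint[OF Gpos sl[OF v] sl[OF v']] by (simp add: F0 G0 cinner_simps)
  finally show ?thesis using n by simp
qed

subsection \<open>Steered codes\<close>

definition block :: "('a \<times> 'j) operator \<Rightarrow> 'a \<Rightarrow> 'a \<Rightarrow> 'j operator" where
  "block X a a' = (\<lambda>y y'. X (a, y) (a', y'))"

definition lift :: "'a vector \<Rightarrow> 'j vector \<Rightarrow> ('a \<times> 'j) vector" where
  "lift m w = (\<lambda>(a, y). m a * w y)"

lemma operators_block: "X \<in> operators (A \<times> J) \<Longrightarrow> block X a a' \<in> operators J"
  by (auto simp: block_def operators_def)

text \<open>Steering is linear in the blocks of \<open>X\<close>, with the entries of
  \<open>M\<close> as coefficients. In this form a linear map on the second factor can be pulled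
  through the sum.\<close>

lemma ptrace_fst_mult_tensor:
  assumes "finite J" "X \<in> operators (A \<times> J)"
  shows "ptrace_fst A (op_mult (A \<times> J) (op_tensor M (op_id J)) X) =
    (\<Sum>p\<in>A \<times> A. op_scale (M (fst p) (snd p)) (block X (snd p) (fst p)))"
proof (intro ext)
  fix y y'
  have id: "(\<Sum>z\<in>J. op_id J y z * X (b, z) (a, y')) = X (b, y) (a, y')" for a b
  proof (cases "y \<in> J")
    case True
    then have "(\<Sum>z\<in>J. op_id J y z * X (b, z) (a, y')) = (\<Sum>z\<in>J. if y = z then X (b, z) (a, y') else 0)"
      by (intro sum.cong) (auto simp: op_id_def)
    then show ?thesis using True assms(1) by simp
  next
    case False
    then show ?thesis using assms(2) by (simp add: op_id_def operators_def)
  qed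
  have "ptrace_fst A (op_mult (A \<times> J) (op_tensor M (op_id J)) X) y y' =
      (\<Sum>a\<in>A. \<Sum>b\<in>A. \<Sum>z\<in>J. M a b * (op_id J y z * X (b, z) (a, y')))"
    by (simp add: ptrace_fst_def op_mult_def op_tensor_def sum.cartesian_product' mult.assoc)
  also have "\<dots> = (\<Sum>a\<in>A. \<Sum>b\<in>A. M a b * X (b, y) (a, y'))"
    by (simp only: id flip: sum_distrib_left)
  also have "\<dots> = (\<Sum>p\<in>A \<times> A. op_scale (M (fst p) (snd p)) (block X (snd p) (fst p))) y y'"
    by (simp add: sum_fun_app op_scale_def block_def sum.cartesian_product')
  finally show "ptrace_fst A (op_mult (A \<times> J) (op_tensor M (op_id J)) X) y y' =
      (\<Sum>p\<in>A \<times> A. op_scale (M (fst p) (snd p)) (block X (snd p) (fst p))) y y'" .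
qed

lemma operators_ptrace_fst_mult_tensor:
  "finite J \<Longrightarrow> X \<in> operators (A \<times> J) \<Longrightarrow>
    ptrace_fst A (op_mult (A \<times> J) (op_tensor M (op_id J)) X) \<in> operators J"
  unfolding ptrace_fst_mult_tensor by (intro operators_sum operators_op_scale operators_block)

text \<open>\<open>lift m\<close> is the adjoint of \<open>contract A m\<close>; statements about
  \<open>X\<close> on product vectors thus become statements about contracted code vectors.\<close>

lemma cinner_lift: "cinner (A \<times> J) (lift m w) v = cinner J w (contract A m v)"
proof -
  have "cinner (A \<times> J) (lift m w) v = (\<Sum>a\<in>A. \<Sum>y\<in>J. cnj (w y) * (cnj (m a) * v (a, y)))"
    by (simp add: cinner_def lift_def sum.cartesian_product' mult_ac)
  also have "\<dots> = (\<Sum>y\<in>J. \<Sum>a\<in>A. cnj (w y) * (cnj (m a) * v (a, y)))"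
    by (rule sum.swap)
  finally show ?thesis by (simp add: cinner_def contract_def sum_distrib_left)
qed

lemma cinner_block:
  "cinner (A \<times> J) (lift m w) (op_apply (A \<times> J) X (lift m w)) =
    (\<Sum>p\<in>A \<times> A. m (fst p) * cnj (m (snd p)) * cinner J w (op_apply J (block X (snd p) (fst p)) w))"
proof -
  have "cinner (A \<times> J) (lift m w) (op_apply (A \<times> J) X (lift m w)) =
      (\<Sum>b\<in>A. \<Sum>y\<in>J. \<Sum>a\<in>A. \<Sum>z\<in>J. m a * cnj (m b) * (cnj (w y) * X (b, y) (a, z) * w z))"
    by (simp add: cinner_op_apply lift_def sum.cartesian_product' mult_ac)
  also have "\<dots> = (\<Sum>b\<in>A. \<Sum>a\<in>A. \<Sum>y\<in>J. \<Sum>z\<in>J. m a * cnj (m b) * (cnj (w y) * X (b, y) (a, z) * w z))"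
    by (intro sum.cong refl sum.swap)
  also have "\<dots> = (\<Sum>a\<in>A. \<Sum>b\<in>A. \<Sum>y\<in>J. \<Sum>z\<in>J. m a * cnj (m b) * (cnj (w y) * X (b, y) (a, z) * w z))"
    by (rule sum.swap)
  finally show ?thesis
    by (simp add: cinner_op_apply block_def sum.cartesian_product' sum_distrib_left)
qed

text \<open>A rank-one decomposition of \<open>M\<close> turns the form into a sum over product
  vectors. For positive \<open>X\<close> all terms are nonnegative, so positivity and the kernel of
  the steered operator can be read off.\<close>

lemma cinner_steered:
  assumes "finite J" "X \<in> operators (A \<times> J)" "M = (\<Sum>k\<in>K. outer (t k) (t k))"
  shows "cinner J w (op_apply J (ptrace_fst A (op_mult (A \<times> J) (op_tensor M (op_id J)) X)) w) =
    (\<Sum>k\<in>K. cinner (A \<times> J) (lift (t k) w) (op_apply (A \<times> J) X (lift (t k) w)))"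
proof -
  have "cinner J w (op_apply J (ptrace_fst A (op_mult (A \<times> J) (op_tensor M (op_id J)) X)) w) =
      (\<Sum>p\<in>A \<times> A. \<Sum>k\<in>K. t k (fst p) * cnj (t k (snd p)) * cinner J w (op_apply J (block X (snd p) (fst p)) w))"
    unfolding ptrace_fst_mult_tensor[OF assms(1,2)] cinner_op_apply_sum cinner_op_apply_lin
    by (simp add: assms(3) sum_fun_app outer_def sum_distrib_right)
  also have "\<dots> = (\<Sum>k\<in>K. cinner (A \<times> J) (lift (t k) w) (op_apply (A \<times> J) X (lift (t k) w)))"
    unfolding cinner_block by (rule sum.swap)
  finally show ?thesis .
qed

lemma vectors_lift: "m \<in> vectors A \<Longrightarrow> w \<in> vectors J \<Longrightarrow> lift m w \<in> vectors (A \<times> J)"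
  by (auto simp: vectors_def lift_def)

text \<open>Contraction by each \<open>t k\<close> maps \<open>V\<close> into \<open>W\<close>. One
  of these maps is nonzero on \<open>V\<close>, hence injective there by \<open>KL\<close>, and
  equal dimensions make it onto.\<close>

lemma supp_steered:
  assumes fin: "finite A" "finite J" and M: "positive A M" and X: "positive (A \<times> J) X"
    and V: "V = supp (A \<times> J) X"
    and W: "W = supp J (ptrace_fst A (op_mult (A \<times> J) (op_tensor M (op_id J)) X))"
    and KL: "\<And>m. \<exists>c. \<forall>v\<in>V. \<forall>w\<in>V.
      cinner J (contract A m v) (contract A m w) = c * cinner (A \<times> J) v w"
    and dim: "cvec.dim V = cvec.dim W" "cvec.dim W > 0"
  shows "positive J (ptrace_fst A (op_mult (A \<times> J) (op_tensor M (op_id J)) X))"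
    and "\<exists>m. W = contract A m ` V"
proof -
  define Y where "Y = ptrace_fst A (op_mult (A \<times> J) (op_tensor M (op_id J)) X)"
  obtain t where t: "\<And>k. k \<in> A \<Longrightarrow> t k \<in> vectors A" "M = (\<Sum>k\<in>A. outer (t k) (t k))"
    using positive_decomposition[OF fin(1) M] by blast
  let ?q = "\<lambda>k w. cinner (A \<times> J) (lift (t k) w) (op_apply (A \<times> J) X (lift (t k) w))"
  have XO: "X \<in> operators (A \<times> J)" using X by (rule positive_operators)
  have Y: "cinner J w (op_apply J Y w) = (\<Sum>k\<in>A. ?q k w)" for w
    unfolding Y_def by (rule cinner_steered[OF fin(2) XO t(2)])
  have q: "?q k w \<in> \<real>\<^sub>\<ge>\<^sub>0" if "k \<in> A" "w \<in> vectors J" for k w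
    using that t(1) by (intro positive_cinner[OF X] vectors_lift)
  have Ypos: "positive J Y"
  proof (rule positiveI)
    show "Y \<in> operators J" unfolding Y_def by (rule operators_ptrace_fst_mult_tensor[OF fin(2) XO])
    show "cinner J w (op_apply J Y w) \<in> \<real>\<^sub>\<ge>\<^sub>0" if "w \<in> vectors J" for w
      unfolding Y using q that by (intro sum_nonneg_Reals)
  qed
  then show "positive J (ptrace_fst A (op_mult (A \<times> J) (op_tensor M (op_id J)) X))"
    by (simp add: Y_def)
  have WY: "W = supp J Y" by (simp add: W Y_def)
  have subV: "subspace_of (A \<times> J) V" unfolding V by (rule supp_subspace[OF XO])
  have subW: "subspace_of J W" unfolding WY by (rule supp_subspace[OF positive_operators[OF Ypos]])
  have vec: "contract A m v \<in> vectors J" if "v \<in> V" for m v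
    using that subV by (auto simp: subspace_of_def intro: vectors_contract)
  \<comment> \<open>\<open>W\<close> is the orthogonal complement of the kernel of \<open>Y\<close>.
    For \<open>w\<close> in that kernel each nonnegative term \<open>?q k w\<close> vanishes, so
    \<open>X\<close> annihilates \<open>lift (t k) w\<close>.\<close>
  have into: "contract A (t k) v \<in> W" if k: "k \<in> A" and v: "v \<in> V" for k v
    unfolding WY
  proof (rule in_suppI[OF fin(2) Ypos vec[OF v]])
    fix w assume w: "w \<in> vectors J" "op_apply J Y w = 0"
    obtain u where u: "u \<in> vectors (A \<times> J)" "v = op_apply (A \<times> J) X u"
      using v by (auto simp: V supp_def)
    have l: "lift (t k) w \<in> vectors (A \<times> J)" using k w(1) t(1) by (intro vectors_lift)
    have "(\<Sum>k\<in>A. ?q k w) = 0" using w(2) Y[of w] by (simp add: cinner_simps)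
    then have "?q k w = 0" using q w(1) k fin(1) sum_nonneg_Reals_eq_0[of A "\<lambda>k. ?q k w" k] by blast
    then have "op_apply (A \<times> J) X (lift (t k) w) = 0"
      using l fin by (intro positive_kernel[OF _ X]) auto
    then have "cinner (A \<times> J) v (lift (t k) w) = 0"
      using positive_adjoint[OF X u(1) l] by (simp add: u(2) cinner_simps)
    then show "cinner J (contract A (t k) v) w = 0"
      using cinner_commute[of "A \<times> J" v "lift (t k) w"] cinner_commute[of J "contract A (t k) v" w]
      by (simp add: cinner_lift)
  qed
  \<comment> \<open>If all these contractions vanished on \<open>V\<close>, then \<open>Y\<close>
    would be 0 and \<open>W\<close> zero-dimensional.\<close>
  have "\<exists>k\<in>A. \<exists>v\<in>V. contract A (t k) v \<noteq> 0"
  proof (rule ccontr)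
    assume "\<not> ?thesis"
    then have zero: "contract A (t k) v = 0" if "k \<in> A" "v \<in> V" for k v using that by blast
    have "op_apply J Y w = 0" if w: "w \<in> vectors J" for w
    proof (rule positive_kernel[OF fin(2) Ypos w])
      have "?q k w = 0" if k: "k \<in> A" for k
      proof -
        have "op_apply (A \<times> J) X (lift (t k) w) \<in> V"
          unfolding V supp_def using k w t(1) by (intro imageI vectors_lift)
        then show ?thesis by (simp add: cinner_lift zero[OF k] cinner_simps)
      qed
      then show "cinner J w (op_apply J Y w) = 0" by (simp add: Y)
    qed
    then have "W \<subseteq> cvec.span {}" by (auto simp: WY supp_def)
    then have "cvec.dim W \<le> card ({} :: 'b vector set)" by (intro cvec.dim_le_card) auto
    with dim(2) show False by simp
  qed
  then obtain k v where k: "k \<in> A" and v: "v \<in> V" "contract A (t k) v \<noteq> 0" by blast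
  obtain c where "\<forall>v\<in>V. \<forall>w\<in>V.
      cinner J (contract A (t k) v) (contract A (t k) w) = c * cinner (A \<times> J) v w"
    using KL ..
  note c = this[rule_format]
  have "cinner J (contract A (t k) v) (contract A (t k) v) \<noteq> 0"
    using v(2) by (simp add: cinner_self_eq_0_iff[OF fin(2) vec[OF v(1)]])
  then have "c \<noteq> 0" using c[OF v(1) v(1)] by auto
  have "contract A (t k) ` V = W"
  proof (rule cvec_linear_image_eq)
    show "u = 0" if "u \<in> V" "contract A (t k) u = 0" for u
    proof -
      have "cinner (A \<times> J) u u = 0" using c[OF that(1) that(1)] that(2) \<open>c \<noteq> 0\<close> by (simp add: cinner_simps)
      moreover have "u \<in> vectors (A \<times> J)" using that(1) subV by (auto simp: subspace_of_def)
      ultimately show ?thesis using fin by (simp add: cinner_self_eq_0_iff)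
    qed
  qed (use subV subW into[OF k] dim in \<open>auto simp: contract_simps subspace_of_def\<close>)
  then show "\<exists>m. W = contract A m ` V" by blast
qed

text \<open>If \<open>X\<close> dominates a positive multiple of \<open>Y\<close>, the form of
  \<open>Y\<close> vanishes on the kernel of \<open>X\<close>; passing to orthogonal complements
  reverses the inclusion of kernels.\<close>

lemma supp_mono:
  assumes "finite I" "positive I X" "positive I Y" "r > 0"
    and diff: "positive I (X - op_scale (of_real r) Y)"
  shows "supp I Y \<subseteq> supp I X"
proof
  fix x assume "x \<in> supp I Y"
  then obtain u where u: "u \<in> vectors I" "x = op_apply I Y u" by (auto simp: supp_def)
  show "x \<in> supp I X"
  proof (rule in_suppI[OF assms(1,2)])
    show "x \<in> vectors I" unfolding u(2) by (intro vectors_op_apply positive_operators assms)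
    fix w assume w: "w \<in> vectors I" "op_apply I X w = 0"
    have "- (of_real r * cinner I w (op_apply I Y w)) \<in> \<real>\<^sub>\<ge>\<^sub>0"
      using positive_cinner[OF diff w(1)] w(2) by (simp add: cinner_op_apply_lin cinner_simps)
    moreover have Yw: "cinner I w (op_apply I Y w) \<in> \<real>\<^sub>\<ge>\<^sub>0" by (rule positive_cinner[OF assms(3) w(1)])
    ultimately have "cinner I w (op_apply I Y w) = 0"
      using \<open>r > 0\<close> by (auto simp: complex_nonneg_Reals_iff complex_eq_iff mult_le_0_iff)
    then have "op_apply I Y w = 0" by (rule positive_kernel[OF assms(1,3) w(1)])
    then show "cinner I x w = 0"
      using positive_adjoint[OF assms(3) u(1) w(1)] by (simp add: u(2) cinner_simps)
  qed
qed

section \<open>Encoding of steered states\<close>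

lemma positive_tensor_id:
  assumes "finite Q" "positive I X"
  shows "positive (I \<times> Q) (op_tensor X (op_id Q))"
proof (rule positiveI)
  show "op_tensor X (op_id Q) \<in> operators (I \<times> Q)"
    using positive_operators[OF assms(2)] by (auto simp: operators_def op_tensor_def op_id_def)
  fix v assume v: "v \<in> vectors (I \<times> Q)"
  let ?v = "\<lambda>q x. v (x, q)"
  have "cinner (I \<times> Q) v (op_apply (I \<times> Q) (op_tensor X (op_id Q)) v) =
      (\<Sum>x\<in>I. \<Sum>q\<in>Q. \<Sum>y\<in>I. \<Sum>r\<in>Q. if q = r then cnj (v (x, q)) * X x y * v (y, r) else 0)"
    unfolding cinner_op_apply sum.cartesian_product'
    by (intro sum.cong refl) (simp add: op_tensor_def op_id_def)
  also have "\<dots> = (\<Sum>x\<in>I. \<Sum>q\<in>Q. \<Sum>y\<in>I. cnj (v (x, q)) * X x y * v (y, q))"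
    using assms(1) by simp
  also have "\<dots> = (\<Sum>q\<in>Q. cinner I (?v q) (op_apply I X (?v q)))"
    unfolding cinner_op_apply by (rule sum.swap)
  also have "\<dots> \<in> \<real>\<^sub>\<ge>\<^sub>0"
    using v by (intro sum_nonneg_Reals positive_cinner[OF assms(2)]) (simp add: vectors_def)
  finally show "cinner (I \<times> Q) v (op_apply (I \<times> Q) (op_tensor X (op_id Q)) v) \<in> \<real>\<^sub>\<ge>\<^sub>0" .
qed

lemma op_trace_tensor_id: "op_trace (I \<times> Q) (op_tensor X (op_id Q)) = of_nat (card Q) * op_trace I X"
  by (simp add: op_trace_def op_tensor_def op_id_def sum.cartesian_product' sum_distrib_left)

lemma positive_op_assoc:
  assumes "positive ((A \<times> D) \<times> Q) X"
  shows "positive (A \<times> D \<times> Q) (op_assoc X)"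
proof -
  let ?f = "\<lambda>(a, d, q). ((a, d), q)"
  have f: "bij_betw ?f (A \<times> D \<times> Q) ((A \<times> D) \<times> Q)"
    by (rule bij_betw_byWitness[where f' = "\<lambda>((a, d), q). (a, d, q)"]) auto
  have "(\<lambda>x y. if x \<in> A \<times> D \<times> Q \<and> y \<in> A \<times> D \<times> Q then X (?f x) (?f y) else 0) = op_assoc X"
    using positive_operators[OF assms] by (auto simp: fun_eq_iff op_assoc_def operators_def)
  with positive_reindex[OF f assms] show ?thesis by simp
qed

text \<open>Measurement on \<open>A\<close> and encoding act on different systems and so commute:
  encoding the steered state of \<open>D\<close> with the identity on \<open>Q\<close> gives the
  operator steered from \<open>\<tau>\<close>. Block by block, this is linearity of
  \<open>\<E>\<close>.\<close>

lemma channel_steered: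
  assumes fin: "finite D" "finite B" and E: "channel (D \<times> Q) B \<E>"
    and \<psi>: "\<psi> \<in> operators (A \<times> D)"
    and \<tau>: "\<tau> = id_tensor \<E> (op_assoc (op_tensor \<psi> (op_id Q)))" "\<tau> \<in> operators (A \<times> B)"
  shows "\<E> (op_tensor (ptrace_fst A (op_mult (A \<times> D) (op_tensor M (op_id D)) \<psi>)) (op_id Q)) =
    ptrace_fst A (op_mult (A \<times> B) (op_tensor M (op_id B)) \<tau>)"
proof -
  let ?T = "\<lambda>p. op_tensor (block \<psi> (snd p) (fst p)) (op_id Q)"
  have T: "?T p \<in> operators (D \<times> Q)" for p
    using operators_block[OF \<psi>, of "snd p" "fst p"]
    by (auto simp: operators_def op_tensor_def op_id_def)
  have "op_tensor (ptrace_fst A (op_mult (A \<times> D) (op_tensor M (op_id D)) \<psi>)) (op_id Q) =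
      (\<Sum>p\<in>A \<times> A. op_scale (M (fst p) (snd p)) (?T p))"
    unfolding ptrace_fst_mult_tensor[OF fin(1) \<psi>]
    by (auto simp: fun_eq_iff op_tensor_def sum_fun_app op_scale_def sum_distrib_right mult.assoc)
  moreover have "\<E> (?T p) = block \<tau> (snd p) (fst p)" for p
  proof -
    have "?T p = (\<lambda>x x'. op_assoc (op_tensor \<psi> (op_id Q)) (snd p, x) (fst p, x'))"
      by (auto simp: fun_eq_iff op_tensor_def op_assoc_def block_def)
    then show ?thesis by (simp add: block_def \<tau>(1) id_tensor_def)
  qed
  ultimately show ?thesis
    unfolding ptrace_fst_mult_tensor[OF fin(2) \<tau>(2)] by (simp add: channel_sum[OF E T])
qed

section \<open>Sums over hidden states\<close>

lemma has_sum_swap_sum: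
  fixes f :: "'k \<Rightarrow> 'l \<Rightarrow> complex"
  assumes "\<And>k. k \<in> K \<Longrightarrow> (f k has_sum s k) L"
  shows "((\<lambda>l. \<Sum>k\<in>K. f k l) has_sum (\<Sum>k\<in>K. s k)) L"
  using assms by (induction K rule: infinite_finite_induct) (auto intro: has_sum_add)

text \<open>The difference is the contribution of the other hidden states. In the quadratic form at
  \<open>v\<close>, a single nonnegative term is bounded by the whole convergent sum, also when
  \<open>\<Lambda>\<close> is infinite.\<close>

lemma hidden_state_dominated:
  assumes "finite D" "\<sigma> \<in> operators D" "\<And>l. l \<in> \<Lambda> \<Longrightarrow> positive D (\<rho> l)"
    and p: "\<And>l. l \<in> \<Lambda> \<Longrightarrow> 0 \<le> p l"
    and sum: "\<And>x y. x \<in> D \<Longrightarrow> y \<in> D \<Longrightarrow> ((\<lambda>l. of_real (p l) * \<rho> l x y) has_sum \<sigma> x y) \<Lambda>"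
    and l: "l \<in> \<Lambda>"
  shows "positive D (\<sigma> - op_scale (of_real (p l)) (\<rho> l))"
proof (rule positiveI)
  show "\<sigma> - op_scale (of_real (p l)) (\<rho> l) \<in> operators D"
    using assms(2) positive_operators[OF assms(3)[OF l]] by (auto simp: operators_def op_scale_def)
  fix v assume v: "v \<in> vectors D"
  define g where "g = (\<lambda>l. of_real (p l) * cinner D v (op_apply D (\<rho> l) v))"
  have "((\<lambda>l. \<Sum>x\<in>D. \<Sum>y\<in>D. cnj (v x) * (of_real (p l) * \<rho> l x y) * v y) has_sum
      (\<Sum>x\<in>D. \<Sum>y\<in>D. cnj (v x) * \<sigma> x y * v y)) \<Lambda>"
    by (intro has_sum_swap_sum has_sum_cmult_right has_sum_cmult_left sum)
  then have g: "(g has_sum cinner D v (op_apply D \<sigma> v)) \<Lambda>"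
    by (simp add: g_def cinner_op_apply sum_distrib_left mult_ac)
  have nonneg: "g l \<in> \<real>\<^sub>\<ge>\<^sub>0" if "l \<in> \<Lambda>" for l
    unfolding g_def using p[OF that] positive_cinner[OF assms(3)[OF that] v] by (intro nonneg_Reals_mult_I) auto
  have "Re (g l) \<le> Re (cinner D v (op_apply D \<sigma> v))"
    using finite_sum_le_has_sum[OF has_sum_Re[OF g], of "{l}"] l nonneg
    by (auto simp: complex_nonneg_Reals_iff)
  moreover have "Im (cinner D v (op_apply D \<sigma> v)) = 0"
  proof (rule has_sum_unique[OF has_sum_Im[OF g]])
    show "((\<lambda>l. Im (g l)) has_sum 0) \<Lambda>"
      using nonneg by (intro has_sum_0) (auto simp: complex_nonneg_Reals_iff)
  qed
  moreover have "cinner D v (op_apply D (\<sigma> - op_scale (of_real (p l)) (\<rho> l)) v) =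
      cinner D v (op_apply D \<sigma> v) - g l"
    by (simp add: cinner_op_apply_lin g_def)
  ultimately show "cinner D v (op_apply D (\<sigma> - op_scale (of_real (p l)) (\<rho> l)) v) \<in> \<real>\<^sub>\<ge>\<^sub>0"
    using nonneg[OF l] by (simp add: complex_nonneg_Reals_iff)
qed

lemma channel_minus_scale_tensor_id:
  assumes E: "channel (D \<times> Q) B \<E>" and "X \<in> operators D" "Y \<in> operators D"
  shows "\<E> (op_tensor (X - op_scale c Y) (op_id Q)) =
    \<E> (op_tensor X (op_id Q)) - op_scale c (\<E> (op_tensor Y (op_id Q)))"
proof -
  have ops: "op_tensor Z (op_id Q) \<in> operators (D \<times> Q)" if "Z \<in> operators D" for Z
    using that by (auto simp: operators_def op_tensor_def op_id_def)
  have "op_tensor (X - op_scale c Y) (op_id Q) =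
      op_tensor X (op_id Q) + op_scale (- c) (op_tensor Y (op_id Q))"
    by (auto simp: fun_eq_iff op_tensor_def op_scale_def algebra_simps)
  then have "\<E> (op_tensor (X - op_scale c Y) (op_id Q)) =
      \<E> (op_tensor X (op_id Q)) + op_scale (- c) (\<E> (op_tensor Y (op_id Q)))"
    using assms by (simp add: ops channel_add[OF E] channel_scale[OF E] operators_op_scale)
  then show ?thesis by (simp add: fun_eq_iff op_scale_def)
qed

section \<open>Necessity of steering\<close>

theorem proposition2:
  fixes n :: nat
    and Bs :: "nat \<Rightarrow> 'b set" and A :: "'a set" and D :: "'d set" and Q :: "'q set"
    and Idx :: "'i set" and Out :: "'i \<Rightarrow> 'o set" and \<Gamma> :: "'i \<Rightarrow> nat set set"
    and \<psi> :: "('a \<times> 'd) operator"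
    and \<E> :: "('d \<times> 'q) operator \<Rightarrow> (nat \<Rightarrow> 'b) operator"
    and M :: "'o \<Rightarrow> 'i \<Rightarrow> 'a operator"
  assumes "\<And>k. k \<in> {1..n} \<Longrightarrow> hilbert_basis (Bs k)"
    and "hilbert_basis A" and "hilbert_basis D" and "hilbert_basis Q"
    and "programmable_access_structure {1..n} Bs A D Q Idx Out \<Gamma> \<psi> \<E> M"
    and "\<exists>i\<in>Idx. \<exists>j\<in>Idx. \<Gamma> i \<noteq> \<Gamma> j"
  shows "\<not> (\<exists>(\<Lambda>::'l set) \<rho> p.
            local_hidden_state_model D Idx Out (assemblage A D \<psi> M) \<Lambda> \<rho> p)"
proof
  assume "\<exists>(\<Lambda>::'l set) \<rho> p. local_hidden_state_model D Idx Out (assemblage A D \<psi> M) \<Lambda> \<rho> p"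
  then obtain \<Lambda> :: "'l set" and \<rho> p where
    lhs: "local_hidden_state_model D Idx Out (assemblage A D \<psi> M) \<Lambda> \<rho> p" by (elim exE)
  define B where "B = PiE {1..n} Bs"
  define \<tau> where "\<tau> = id_tensor \<E> (op_assoc (op_tensor \<psi> (op_id Q)))"
  define V where "V = supp (A \<times> B) \<tau>"
  \<comment> \<open>The steered operators, whose supports are the codes
    \<open>V\<^sub>a\<^sub>|\<^sub>i\<close>.\<close>
  define Y where "Y = (\<lambda>a i. ptrace_fst A (op_mult (A \<times> B) (op_tensor (M a i) (op_id B)) \<tau>))"
  note pas = assms(5)[unfolded programmable_access_structure_def Let_def,
    folded B_def, folded \<tau>_def, folded V_def]
  have finite_Bs: "finite (Bs k)" if "k \<in> {1..n}" for k
    using assms(1)[OF that] by (simp add: hilbert_basis_def)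
  have "finite B" unfolding B_def by (rule finite_PiE[OF finite_atLeastAtMost finite_Bs])
  then have fin: "finite A" "finite D" "finite Q" "finite B" and Q: "card Q > 0"
    using assms(2-4) by (simp_all add: hilbert_basis_def card_gt_0_iff)
  note pas' = pas[THEN conjunct2]
  have \<psi>: "positive (A \<times> D) \<psi>"
    using pas'[THEN conjunct1] by (simp add: density_operator_def)
  note pas' = pas'[THEN conjunct2]
  have E: "channel (D \<times> Q) B \<E>" by (rule pas'[THEN conjunct1])
  note pas' = pas'[THEN conjunct2]
  have M: "positive A (M a i)" if "i \<in> Idx" "a \<in> Out i" for i a
    using pas'[THEN conjunct1] that by (simp add: povm_def)
  note pas' = pas'[THEN conjunct2]
  have code: "erasure_code A B Q V" by (rule pas'[THEN conjunct2])
  have qss: "cvec.dim (supp B (Y a i)) = card Q" "access_structure {1..n} Bs (supp B (Y a i)) = \<Gamma> i"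
    if "i \<in> Idx" "a \<in> Out i" for i a
    using pas'[THEN conjunct1, rule_format, OF that] by (simp_all add: Y_def qss_code_def)
  have \<tau>: "positive (A \<times> B) \<tau>"
    unfolding \<tau>_def using fin \<psi> by (intro positive_id_tensor[OF _ E] positive_op_assoc positive_tensor_id)
  have subV: "subspace_of (A \<times> B) V" and dimV: "cvec.dim V = card Q"
    using code by (auto simp: erasure_code_def)
  have KL: "\<exists>c. \<forall>v\<in>V. \<forall>w\<in>V.
      cinner B (contract A m v) (contract A m' w) = c * cinner (A \<times> B) v w" for m m'
    by (rule contract_inner_scalar[OF fin(1,4) subV])
      (rule erasure_code_slice_orthogonal[OF fin(1,4) code])
  have steered: "positive B (Y a i)" "\<exists>m. supp B (Y a i) = contract A m ` V"
    if ia: "i \<in> Idx" "a \<in> Out i" for i a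
  proof -
    have "cvec.dim V = cvec.dim (supp B (Y a i))" "cvec.dim (supp B (Y a i)) > 0"
      using qss(1)[OF ia] dimV Q by auto
    from supp_steered[OF fin(1,4) M[OF ia] \<tau> V_def Y_def[THEN fun_cong, THEN fun_cong, THEN arg_cong] KL this]
    show "positive B (Y a i)" "\<exists>m. supp B (Y a i) = contract A m ` V"
      by (auto simp: Y_def)
  qed
  have \<rho>: "\<And>l. l \<in> \<Lambda> \<Longrightarrow> positive D (\<rho> l)"
    and tr: "((\<lambda>l. op_trace D (\<rho> l)) has_sum 1) \<Lambda>"
    and p: "\<And>i l a. i \<in> Idx \<Longrightarrow> l \<in> \<Lambda> \<Longrightarrow> a \<in> Out i \<Longrightarrow> 0 \<le> p a i l"
    and p1: "\<And>i l. i \<in> Idx \<Longrightarrow> l \<in> \<Lambda> \<Longrightarrow> (\<Sum>a\<in>Out i. p a i l) = 1"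
    and dec: "\<And>i a x y. i \<in> Idx \<Longrightarrow> a \<in> Out i \<Longrightarrow> x \<in> D \<Longrightarrow> y \<in> D \<Longrightarrow>
      ((\<lambda>l. of_real (p a i l) * \<rho> l x y) has_sum assemblage A D \<psi> M a i x y) \<Lambda>"
    using lhs by (auto simp: local_hidden_state_model_def)
  have "\<exists>l\<in>\<Lambda>. op_trace D (\<rho> l) \<noteq> 0"
  proof (rule ccontr)
    assume "\<not> ?thesis"
    then have "((\<lambda>l. op_trace D (\<rho> l)) has_sum 0) \<Lambda>" by (intro has_sum_0) simp
    from has_sum_unique[OF tr this] show False by simp
  qed
  then obtain l where l: "l \<in> \<Lambda>" "op_trace D (\<rho> l) \<noteq> 0" ..
  \<comment> \<open>The encoded hidden state. It depends on neither setting nor outcome, so a vector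
    of its support can serve all settings at once.\<close>
  define W where "W = \<E> (op_tensor (\<rho> l) (op_id Q))"
  have W: "positive B W"
    unfolding W_def using fin \<rho>[OF l(1)] by (intro channel_positive[OF E] positive_tensor_id)
  have "op_trace B W = of_nat (card Q) * op_trace D (\<rho> l)"
    unfolding W_def op_trace_tensor_id[symmetric]
    by (rule channel_trace[OF E positive_operators[OF positive_tensor_id[OF fin(3) \<rho>[OF l(1)]]]])
  then have trW: "op_trace B W \<noteq> 0" using l(2) Q by simp
  have "\<exists>x\<in>B. W x x \<noteq> 0"
  proof (rule ccontr)
    assume "\<not> ?thesis"
    then have "op_trace B W = 0" unfolding op_trace_def by (intro sum.neutral) blast
    with trW show False by simp
  qed
  then obtain x where x: "x \<in> B" "W x x \<noteq> 0" ..
  \<comment> \<open>A nonzero trace forces a nonzero diagonal entry, and the column through it is a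
    nonzero vector of the support.\<close>
  define w where "w = op_apply B W (ket x)"
  have w: "w \<in> supp B W"
    unfolding w_def supp_def by (intro imageI vectors_ket x)
  have "w x \<noteq> 0" using x fin(4) by (simp add: w_def op_apply_ket)
  then have w0: "w \<noteq> 0" by (metis zero_fun_apply)
  have common: "\<exists>a\<in>Out i. w \<in> supp B (Y a i)" if i: "i \<in> Idx" for i
  proof -
    \<comment> \<open>The probabilities sum to 1, so \<open>Out i\<close> cannot be empty and some
      outcome has positive weight.\<close>
    have "\<exists>a\<in>Out i. p a i l \<noteq> 0"
    proof (rule ccontr)
      assume "\<not> ?thesis"
      then have "(\<Sum>a\<in>Out i. p a i l) = 0" by (intro sum.neutral) blast
      then show False using p1[OF i l(1)] by simp
    qed
    then obtain a where a: "a \<in> Out i" "p a i l > 0" using p[OF i l(1)] by (metis order_le_less)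
    let ?\<sigma> = "assemblage A D \<psi> M a i"
    have \<sigma>: "?\<sigma> \<in> operators D"
      unfolding assemblage_def by (rule operators_ptrace_fst_mult_tensor[OF fin(2) positive_operators[OF \<psi>]])
    have Y: "Y a i = \<E> (op_tensor ?\<sigma> (op_id Q))"
      unfolding Y_def assemblage_def
      by (rule channel_steered[OF fin(2,4) E positive_operators[OF \<psi>] \<tau>_def positive_operators[OF \<tau>], symmetric])
    have "positive D (?\<sigma> - op_scale (of_real (p a i l)) (\<rho> l))"
      by (rule hidden_state_dominated[OF fin(2) \<sigma> \<rho> p[OF i _ a(1)] dec[OF i a(1)] l(1)])
    then have "positive B (\<E> (op_tensor (?\<sigma> - op_scale (of_real (p a i l)) (\<rho> l)) (op_id Q)))"
      using fin by (intro channel_positive[OF E] positive_tensor_id)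
    then have "positive B (Y a i - op_scale (of_real (p a i l)) W)"
      by (simp add: channel_minus_scale_tensor_id[OF E \<sigma> positive_operators[OF \<rho>[OF l(1)]]] Y W_def)
    from supp_mono[OF fin(4) steered(1)[OF i a(1)] W a(2) this] w a(1) show ?thesis by blast
  qed
  have "\<Gamma> i = \<Gamma> j" if i: "i \<in> Idx" and j: "j \<in> Idx" for i j
  proof -
    obtain a b where a: "a \<in> Out i" "w \<in> supp B (Y a i)" and b: "b \<in> Out j" "w \<in> supp B (Y b j)"
      using common[OF i] common[OF j] by blast
    obtain m m' where m: "supp B (Y a i) = contract A m ` V" and m': "supp B (Y b j) = contract A m' ` V"
      using steered(2)[OF i a(1)] steered(2)[OF j b(1)] by blast
    obtain v v' where v: "v \<in> V" "w = contract A m v" and v': "v' \<in> V" "w = contract A m' v'"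
      using a(2) b(2) unfolding m m' by blast
    \<comment> \<open>The shared vector \<open>w\<close> forces the two codes to be the same
      subspace, and a code determines its access structure.\<close>
    have "contract A m ` V = contract A m' ` V"
      using v v' w0 by (intro contract_images_eq[OF fin(1,4) subV KL v(1) v'(1)]) auto
    then show ?thesis using qss(2)[OF i a(1)] qss(2)[OF j b(1)] m m' by simp
  qed
  with assms(6) show False by blast
qed

end
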